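(* Let $p,q\ge5$ be distinct primes, $N=pq$, and $k$ an even integer. Let $h=\frac12\gcd(24,p-1,q-1)$. Then there exist integers $r_\delta$ ($\delta\mid N$) with $f(\tau)=\prod_{\delta\mid N}\eta^{r_\delta}(\delta\tau)\in M_k(\Gamma_1(pq))$ if and only if both of the following hold: (1) $h\mid k$; (2) it is not the case that simultaneously $(p\bmod 24,\ q\bmod 24)\in\{(1,5),(5,1),(5,5)\}$, $p\ne5$, $q\ne5$, and $k=2$.
   Context: $\eta(\tau)=q^{1/24}\prod_{n\ge1}(1-q^n)$, $q=e^{2\pi i\tau}$ (here $q$ in the $q$-expansion variable is not the prime $q$). $M_k(\Gamma_1(N))$ is the space of holomorphic modular forms of weight $k$ on $\Gamma_1(N)$ (holomorphic on the upper half-plane and at all cusps).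
   Formalization: The weight k is assumed to be nonnegative: for negative even k the claim fails (p=5, q=7, h=1, k=-2 satisfies (1) and (2), but there are no nonzero holomorphic modular forms of negative weight). *)

theory Defs
  imports "HOL-Analysis.Analysis" "HOL-Complex_Analysis.Complex_Analysis" "HOL-Number_Theory.Cong"
begin

definition upper_half_plane :: "complex set" where
  "upper_half_plane = {\<tau>. Im \<tau> > 0}"

definition dedekind_eta :: "complex \<Rightarrow> complex" where
  "dedekind_eta \<tau> =
     exp (2 * of_real pi * \<i> * \<tau> / 24) *
     (\<Prod>n. 1 - exp (2 * of_real pi * \<i> * \<tau>) ^ Suc n)"

definition SL2Z :: "(int ^ 2 ^ 2) set" where
  "SL2Z = {\<gamma>. det \<gamma> = 1}"

definition Gamma1 :: "nat \<Rightarrow> (int ^ 2 ^ 2) set" where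
  "Gamma1 N = {\<gamma> \<in> SL2Z. [\<gamma> $ 1 $ 1 = 1] (mod int N) \<and> [\<gamma> $ 2 $ 1 = 0] (mod int N) \<and>
                           [\<gamma> $ 2 $ 2 = 1] (mod int N)}"

definition moebius_act :: "int ^ 2 ^ 2 \<Rightarrow> complex \<Rightarrow> complex" where
  "moebius_act \<gamma> \<tau> =
     (of_int (\<gamma> $ 1 $ 1) * \<tau> + of_int (\<gamma> $ 1 $ 2)) / (of_int (\<gamma> $ 2 $ 1) * \<tau> + of_int (\<gamma> $ 2 $ 2))"

definition slash :: "int \<Rightarrow> (complex \<Rightarrow> complex) \<Rightarrow> int ^ 2 ^ 2 \<Rightarrow> complex \<Rightarrow> complex" where
  "slash k f \<gamma> \<tau> =
     (of_int (\<gamma> $ 2 $ 1) * \<tau> + of_int (\<gamma> $ 2 $ 2)) powi (- k) * f (moebius_act \<gamma> \<tau>)"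

text \<open>The function is, for some width h, a holomorphic function of the local parameter
  exp(2 pi i tau / h) that extends over the puncture 0 of the unit disc.\<close>

definition holomorphic_at_infinity :: "(complex \<Rightarrow> complex) \<Rightarrow> bool" where
  "holomorphic_at_infinity F \<longleftrightarrow>
     (\<exists>h>0. \<exists>g. g holomorphic_on ball 0 1 \<and>
        (\<forall>\<tau>\<in>upper_half_plane. F \<tau> = g (exp (2 * of_real pi * \<i> * \<tau> / of_nat h))))"

text \<open>Every cusp is the image of infinity under some element of SL2Z, so holomorphy at all
  cusps is holomorphy at infinity of all translates under the slash action. Only values on the
  upper half-plane matter: members are total functions with no condition elsewhere.\<close>

definition modular_forms :: "int \<Rightarrow> (int ^ 2 ^ 2) set \<Rightarrow> (complex \<Rightarrow> complex) set" where
  "modular_forms k G = {f.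
     f holomorphic_on upper_half_plane \<and>
     (\<forall>\<gamma>\<in>G. \<forall>\<tau>\<in>upper_half_plane. slash k f \<gamma> \<tau> = f \<tau>) \<and>
     (\<forall>\<gamma>\<in>SL2Z. holomorphic_at_infinity (slash k f \<gamma>))}"

definition eta_quotient :: "nat \<Rightarrow> (nat \<Rightarrow> int) \<Rightarrow> complex \<Rightarrow> complex" where
  "eta_quotient N r \<tau> = (\<Prod>\<delta> | \<delta> dvd N. dedekind_eta (of_nat \<delta> * \<tau>) powi r \<delta>)"

end

theory Submission
  imports Defs
begin

text \<open>
  The Klein forms, built from the Jacobi theta function, transform under \<open>SL\<^sub>2(\<int>)\<close> by weight \<open>-1\<close> and
  without any multiplier. The product of those at the three 2-torsion points is a constant times
  \<open>\<eta>\<^sup>-\<^sup>6\<close>, so \<open>\<eta>\<^sup>2\<^sup>4\<close> is modular of weight 12. The product of those at \<open>j/p\<close>, \<open>1 \<le> j \<le> (p-1)/2\<close>, is a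
  constant times \<open>\<eta>(p\<tau>)/\<eta>(\<tau>)\<^sup>p\<close>, so \<open>E\<^sub>p(\<tau>) = \<eta>(\<tau>)\<^sup>p/\<eta>(p\<tau>)\<close> is modular of weight \<open>(p-1)/2\<close> on
  \<open>\<Gamma>\<^sub>1(p)\<close>. An eta quotient of level \<open>p q\<close> is \<open>\<eta>\<^sup>m\<close> times powers of \<open>E\<^sub>p(\<tau>)\<close>, \<open>E\<^sub>q(\<tau>)\<close> and \<open>E\<^sub>p(q\<tau>)\<close>,
  where \<open>m = \<Sum> \<delta> r\<^sub>\<delta>\<close>; hence it is modular of weight \<open>k\<close> on \<open>\<Gamma>\<^sub>1(p q)\<close> if and only if
  \<open>\<Sum> r\<^sub>\<delta> = 2 k\<close>, \<open>24\<close> divides \<open>\<Sum> \<delta> r\<^sub>\<delta>\<close>, and the orders at the four cusps, which are linear forms in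
  the \<open>r\<^sub>\<delta>\<close>, are nonnegative. Reducing modulo \<open>gcd(24, p-1, q-1)\<close> gives \<open>h | k\<close>. Conversely nonnegative
  exponents exist in every case permitted by the residues modulo 24 except in weight 2 with residues
  \<open>(1,5)\<close>, \<open>(5,1)\<close>, \<open>(5,5)\<close>; there \<open>E\<^sub>5\<close> helps if 5 is one of the primes, and otherwise the cusp
  inequalities force nonnegative exponents, which do not exist.
\<close>

section \<open>The exponential with period 1\<close>

definition expi :: "complex \<Rightarrow> complex" where
  "expi z = exp (2 * of_real pi * \<i> * z)"

lemma expi_add: "expi (a + b) = expi a * expi b"
  by (simp add: expi_def ring_distribs exp_add)

lemma expi_0 [simp]: "expi 0 = 1"
  by (simp add: expi_def)

lemma expi_nonzero [simp]: "expi z \<noteq> 0"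
  by (simp add: expi_def)

lemma expi_minus: "expi (- z) = inverse (expi z)"
  by (simp add: expi_def exp_minus)

lemma expi_diff: "expi (a - b) = expi a / expi b"
  by (simp add: expi_def ring_distribs exp_diff)

lemma expi_of_nat_mult: "expi (of_nat n * z) = expi z ^ n"
  by (induction n) (auto simp: ring_distribs expi_add)

lemma expi_of_int [simp]: "expi (of_int n) = 1"
  unfolding expi_def using exp_plus_2pin [of 0 n] by (simp add: mult_ac)

lemma expi_half [simp]: "expi (1 / 2) = - 1"
  by (simp add: expi_def)

lemma norm_expi: "norm (expi z) = exp (- 2 * pi * Im z)"
  by (simp add: expi_def norm_exp_eq_Re)

lemma norm_expi_less_1: "Im z > 0 \<Longrightarrow> norm (expi z) < 1"
  by (simp add: norm_expi)

lemma expi_eq_1_iff: "expi z = 1 \<longleftrightarrow> z \<in> \<int>"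
proof
  assume "expi z = 1"
  then obtain n :: int where "Re (2 * of_real pi * \<i> * z) = 0"
      "Im (2 * of_real pi * \<i> * z) = real_of_int (2 * n) * pi"
    unfolding expi_def exp_eq_1 by blast
  then have "z = of_int n"
    by (intro complex_eqI) auto
  then show "z \<in> \<int>" by simp
qed (auto elim: Ints_cases)

lemma expi_cong_Ints:
  assumes "a - b \<in> \<int>"
  shows "expi a = expi b"
  using assms expi_diff [of a b] unfolding expi_eq_1_iff [symmetric] by simp

lemma holomorphic_on_expi [holomorphic_intros]:
  "f holomorphic_on S \<Longrightarrow> (\<lambda>z. expi (f z)) holomorphic_on S"
  unfolding expi_def by (intro holomorphic_intros)

lemma continuous_on_expi [continuous_intros]:
  "continuous_on S f \<Longrightarrow> continuous_on S (\<lambda>z. expi (f z))"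
  unfolding expi_def by (intro continuous_intros)

lemma has_field_derivative_expi [derivative_intros]:
  assumes "(f has_field_derivative f') (at z within S)"
  shows "((\<lambda>z. expi (f z)) has_field_derivative expi (f z) * (2 * of_real pi * \<i> * f'))
           (at z within S)"
  unfolding expi_def by (rule derivative_eq_intros assms refl)+ simp

subsection \<open>q-products and the theta function\<close>

definition qpoch :: "complex \<Rightarrow> complex \<Rightarrow> complex" where
  "qpoch w q = (\<Prod>n. 1 - w * q ^ n)"

lemma qpoch_has_prod:
  assumes "norm q < 1"
  shows "(\<lambda>n. 1 - w * q ^ n) has_prod qpoch w q"
proof -
  have "summable (\<lambda>n. norm w * norm q ^ n)"
    using assms by (intro summable_mult summable_geometric) auto
  then have "abs_convergent_prod (\<lambda>n. 1 - w * q ^ n)"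
    by (simp add: abs_convergent_prod_conv_summable norm_mult norm_power)
  then show ?thesis
    unfolding qpoch_def
    using abs_convergent_prod_imp_convergent_prod convergent_prod_has_prod by blast
qed

lemma qpoch_LIMSEQ:
  assumes "norm q < 1"
  shows "(\<lambda>N. \<Prod>n<N. 1 - w * q ^ n) \<longlonglongrightarrow> qpoch w q"
  using qpoch_has_prod [OF assms] has_prod_imp_tendsto' by blast

lemma qpoch_eq_0_iff:
  assumes "norm q < 1"
  shows "qpoch w q = 0 \<longleftrightarrow> (\<exists>n. w * q ^ n = 1)"
  using has_prod_eq_0_iff [OF qpoch_has_prod [OF assms, of w]] by (auto simp: image_iff)

lemma qpoch_rec:
  assumes "norm q < 1"
  shows "qpoch w q = (1 - w) * qpoch (w * q) q"
proof (rule LIMSEQ_unique)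
  show "(\<lambda>N. \<Prod>n<Suc N. 1 - w * q ^ n) \<longlonglongrightarrow> qpoch w q"
    using qpoch_LIMSEQ [OF assms] by (rule LIMSEQ_Suc)
  have "(\<Prod>n<Suc N. 1 - w * q ^ n) = (1 - w) * (\<Prod>n<N. 1 - w * q * q ^ n)" for N
    by (subst prod.lessThan_Suc_shift) (simp add: mult_ac)
  then show "(\<lambda>N. \<Prod>n<Suc N. 1 - w * q ^ n) \<longlonglongrightarrow> (1 - w) * qpoch (w * q) q"
    by (simp only:) (intro tendsto_intros qpoch_LIMSEQ assms)
qed

text \<open>Argument and base both vary, so the result serves theta as a function of
  \<open>z\<close> and eta as a function of \<open>\<tau>\<close>. On a closed disc the maxima of
  the norms of \<open>u\<close> and \<open>v\<close> give a geometric majorant, hence uniform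
  convergence of the partial products.\<close>

lemma holomorphic_on_qpoch:
  assumes "open S" and u: "u holomorphic_on S" and v: "v holomorphic_on S"
    and less: "\<And>z. z \<in> S \<Longrightarrow> norm (v z) < 1"
  shows "(\<lambda>z. qpoch (u z) (v z)) holomorphic_on S"
proof (rule holomorphic_uniform_sequence [OF \<open>open S\<close>])
  show "(\<lambda>z. \<Prod>n<N. 1 - u z * v z ^ n) holomorphic_on S" for N
    by (intro holomorphic_intros u v)
next
  fix x assume "x \<in> S"
  then obtain d where d: "d > 0" "cball x d \<subseteq> S"
    using \<open>open S\<close> open_contains_cball by blast
  let ?C = "cball x d"
  have cu: "continuous_on ?C u" and cv: "continuous_on ?C v"
    using d u v by (meson continuous_on_subset holomorphic_on_imp_continuous_on)+
  have ne: "?C \<noteq> {}" using d by auto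
  obtain y where y: "y \<in> ?C" "\<forall>z\<in>?C. norm (v z) \<le> norm (v y)"
    using continuous_attains_sup [OF compact_cball ne continuous_on_norm [OF cv]] by blast
  obtain y' where y': "y' \<in> ?C" "\<forall>z\<in>?C. norm (u z) \<le> norm (u y')"
    using continuous_attains_sup [OF compact_cball ne continuous_on_norm [OF cu]] by blast
  have "uniformly_convergent_on ?C (\<lambda>N z. \<Prod>n<N. 1 - u z * v z ^ n)"
  proof (rule uniformly_convergent_on_prod')
    show "uniformly_convergent_on ?C (\<lambda>N z. \<Sum>n<N. norm (1 - u z * v z ^ n - 1))"
    proof (rule Weierstrass_m_test')
      show "summable (\<lambda>n. norm (u y') * norm (v y) ^ n)"
        using less [of y] y d by (intro summable_mult summable_geometric) auto
      show "norm (norm (1 - u z * v z ^ n - 1)) \<le> norm (u y') * norm (v y) ^ n"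
        if "z \<in> ?C" for n z
        using y y' that by (auto simp: norm_mult norm_power intro!: mult_mono power_mono)
    qed
  qed (auto intro!: continuous_intros cu cv)
  then obtain g where g: "uniform_limit ?C (\<lambda>N z. \<Prod>n<N. 1 - u z * v z ^ n) g sequentially"
    by (auto simp: uniformly_convergent_on_def)
  have "g z = qpoch (u z) (v z)" if "z \<in> ?C" for z
    using tendsto_uniform_limitI [OF g that] qpoch_LIMSEQ [of "v z" "u z"] less that d
    by (metis LIMSEQ_unique subsetD)
  then have "uniform_limit ?C (\<lambda>N z. \<Prod>n<N. 1 - u z * v z ^ n)
      (\<lambda>z. qpoch (u z) (v z)) sequentially"
    using g by (metis (mono_tags, lifting) uniform_limit_cong')
  then show "\<exists>d>0. cball x d \<subseteq> S \<and> uniform_limit (cball x d)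
      (\<lambda>N z. \<Prod>n<N. 1 - u z * v z ^ n) (\<lambda>z. qpoch (u z) (v z)) sequentially"
    using d by blast
qed

definition euler_prod :: "complex \<Rightarrow> complex" where
  "euler_prod q = qpoch q q"

lemma euler_prod_nonzero:
  assumes "norm q < 1"
  shows "euler_prod q \<noteq> 0"
proof
  assume "euler_prod q = 0"
  then obtain n where "q ^ Suc n = 1"
    using assms by (auto simp: euler_prod_def qpoch_eq_0_iff)
  moreover have "norm (q ^ Suc n) < 1"
    unfolding norm_power using assms power_less_one_iff [of "norm q" "Suc n"] by auto
  ultimately show False by simp
qed

lemma holomorphic_on_euler_prod:
  assumes "open S" "u holomorphic_on S" "\<And>z. z \<in> S \<Longrightarrow> norm (u z) < 1"
  shows "(\<lambda>z. euler_prod (u z)) holomorphic_on S"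
  unfolding euler_prod_def using assms by (intro holomorphic_on_qpoch) auto

lemma dedekind_eta_eq: "dedekind_eta \<tau> = expi (\<tau> / 24) * euler_prod (expi \<tau>)"
  unfolding dedekind_eta_def euler_prod_def qpoch_def expi_def by simp

text \<open>This is the Jacobi theta function divided by \<open>\<eta>\<^sup>3\<close>. With this normalisation the derivative at
  \<open>0\<close> is \<open>2\<pi>\<i>\<close> for every \<open>\<tau>\<close>, so no unknown constant enters its modular transformation.\<close>

definition theta :: "complex \<Rightarrow> complex \<Rightarrow> complex" where
  "theta z \<tau> = - expi (- z / 2) * qpoch (expi z) (expi \<tau>) * qpoch (expi (\<tau> - z)) (expi \<tau>)
                 / euler_prod (expi \<tau>) ^ 2"

section \<open>Quasi-periods and zeros of theta\<close>

lemma theta_add_1: "theta (z + 1) \<tau> = expi (1 / 2) * theta z \<tau>"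
proof -
  have "expi (z + 1) = expi z" "expi (\<tau> - (z + 1)) = expi (\<tau> - z)"
    by (auto intro!: expi_cong_Ints)
  moreover have "expi (- (z + 1) / 2) = expi (1 / 2) * expi (- z / 2)"
    unfolding expi_add [symmetric] by (rule expi_cong_Ints) (auto simp: field_simps)
  ultimately show ?thesis
    by (simp add: theta_def)
qed

text \<open>The first product loses the factor 1 - w, the second gains 1 - 1/w, where w =
  \<open>expi z\<close>. The relation 1 - 1/w = -(1 - w)/w then needs no division by 1 - w, so zeros
  of theta need no separate treatment.\<close>

lemma theta_add_tau:
  assumes "Im \<tau> > 0"
  shows "theta (z + \<tau>) \<tau> = expi (1 / 2 - z - \<tau> / 2) * theta z \<tau>"
proof -
  let ?q = "expi \<tau>" and ?w = "expi z"
  note q = norm_expi_less_1 [OF assms]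
  have 1: "qpoch ?w ?q = (1 - ?w) * qpoch (expi (z + \<tau>)) ?q"
    using qpoch_rec [OF q, of ?w] by (simp add: expi_add)
  have 2: "qpoch (expi (- z)) ?q = (1 - inverse ?w) * qpoch (expi (\<tau> - z)) ?q"
    using qpoch_rec [OF q, of "expi (- z)"] by (simp add: expi_diff expi_minus field_simps)
  have 3: "expi (- (z + \<tau>) / 2) = expi (- z / 2) / expi (\<tau> / 2)"
    unfolding expi_diff [symmetric] by (rule arg_cong [where f = expi]) (simp add: field_simps)
  have 4: "expi (1 / 2 - z - \<tau> / 2) = - 1 / ?w / expi (\<tau> / 2)"
    by (simp add: expi_diff)
  have 5: "qpoch (expi (z + \<tau>)) ?q * qpoch (expi (- z)) ?q =
        - 1 / ?w * (qpoch ?w ?q * qpoch (expi (\<tau> - z)) ?q)"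
    unfolding 1 2 by (simp add: field_simps)
  have "theta (z + \<tau>) \<tau> = - (expi (- z / 2) / expi (\<tau> / 2)) *
      (qpoch (expi (z + \<tau>)) ?q * qpoch (expi (- z)) ?q) / euler_prod ?q ^ 2"
    unfolding theta_def 3 by simp
  then show ?thesis
    unfolding 5 4 theta_def by (simp add: field_simps)
qed

text \<open>The one-step laws are iterated in both directions. Along \<open>\<tau>\<close> the
  exponent of each step is linear in the step number, so the total is quadratic in
  \<open>m\<close>.\<close>

lemma theta_shift:
  assumes "Im \<tau> > 0"
  shows "theta (z + of_int m * \<tau> + of_int n) \<tau> =
         expi ((of_int m + of_int n) / 2 - of_int m * z - of_int m ^ 2 * \<tau> / 2) * theta z \<tau>"
proof -
  have one: "theta (z + of_int n) \<tau> = expi (of_int n / 2) * theta z \<tau>" for z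
  proof (induction n rule: int_induct [where k = 0])
    case (step1 i)
    have "theta (z + of_int (i + 1)) \<tau> = expi (1 / 2) * theta (z + of_int i) \<tau>"
      using theta_add_1 [of "z + of_int i"] by (simp add: add_ac)
    then show ?case
      using step1 by (simp add: add_divide_distrib expi_add)
  next
    case (step2 i)
    have "theta (z + of_int i) \<tau> = expi (1 / 2) * theta (z + of_int (i - 1)) \<tau>"
      using theta_add_1 [of "z + of_int (i - 1)"] by (simp add: add_ac)
    then have "theta (z + of_int (i - 1)) \<tau> = - (expi (of_int i / 2) * theta z \<tau>)"
      using step2 by simp
    then show ?case
      by (simp add: diff_divide_distrib expi_diff)
  qed simp
  have step: "theta (z + of_int (m + 1) * \<tau>) \<tau> =
      expi (1 / 2 - (z + of_int m * \<tau>) - \<tau> / 2) * theta (z + of_int m * \<tau>) \<tau>" for m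
    using theta_add_tau [OF assms, of "z + of_int m * \<tau>"] by (simp add: algebra_simps)
  have "theta (z + of_int m * \<tau>) \<tau> =
      expi (of_int m / 2 - of_int m * z - of_int m ^ 2 * \<tau> / 2) * theta z \<tau>"
  proof (induction m rule: int_induct [where k = 0])
    case (step1 i)
    have e: "1 / 2 - (z + of_int i * \<tau>) - \<tau> / 2 + (of_int i / 2 - of_int i * z - of_int i ^ 2 * \<tau> / 2)
        = of_int (i + 1) / 2 - of_int (i + 1) * z - of_int (i + 1) ^ 2 * \<tau> / 2"
      by (simp add: field_simps power2_eq_square)
    show ?case
      unfolding step step1 mult.assoc [symmetric] expi_add [symmetric] e ..
  next
    case (step2 i)
    have "expi (of_int i / 2 - of_int i * z - of_int i ^ 2 * \<tau> / 2) * theta z \<tau> =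
        expi (1 / 2 - (z + of_int (i - 1) * \<tau>) - \<tau> / 2) * theta (z + of_int (i - 1) * \<tau>) \<tau>"
      using step [of "i - 1"] step2 by simp
    then have "theta (z + of_int (i - 1) * \<tau>) \<tau> =
       expi (of_int i / 2 - of_int i * z - of_int i ^ 2 * \<tau> / 2)
         / expi (1 / 2 - (z + of_int (i - 1) * \<tau>) - \<tau> / 2) * theta z \<tau>"
      by simp
    moreover have "of_int i / 2 - of_int i * z - of_int i ^ 2 * \<tau> / 2
         - (1 / 2 - (z + of_int (i - 1) * \<tau>) - \<tau> / 2) =
       of_int (i - 1) / 2 - of_int (i - 1) * z - of_int (i - 1) ^ 2 * \<tau> / 2"
      by (simp add: field_simps power2_eq_square)
    ultimately show ?case
      by (simp only: expi_diff [symmetric])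
  qed simp
  then show ?thesis
    unfolding one by (simp add: mult.assoc [symmetric] expi_add [symmetric] add_divide_distrib algebra_simps)
qed

text \<open>A zero of the first product puts \<open>z + n * \<tau>\<close> in the integers, a zero
  of the second \<open>z - (n + 1) * \<tau>\<close>. Conversely, the zero at 0 is carried to every
  lattice point by quasi-periodicity.\<close>

lemma theta_eq_0_iff:
  assumes "Im \<tau> > 0"
  shows "theta z \<tau> = 0 \<longleftrightarrow> (\<exists>m n :: int. z = of_int m * \<tau> + of_int n)"
proof
  note q = norm_expi_less_1 [OF assms]
  assume "theta z \<tau> = 0"
  then consider n where "expi z * expi \<tau> ^ n = 1" | n where "expi (\<tau> - z) * expi \<tau> ^ n = 1"
    using euler_prod_nonzero [OF q] by (auto simp: theta_def qpoch_eq_0_iff [OF q])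
  then show "\<exists>m n :: int. z = of_int m * \<tau> + of_int n"
  proof cases
    case 1
    then have "z + of_nat n * \<tau> \<in> \<int>"
      by (simp add: expi_eq_1_iff [symmetric] expi_add expi_of_nat_mult)
    then obtain j :: int where "z + of_nat n * \<tau> = of_int j"
      by (auto elim: Ints_cases)
    then have "z = of_int (- int n) * \<tau> + of_int j"
      by (simp add: algebra_simps)
    then show ?thesis by blast
  next
    case 2
    then have "\<tau> - z + of_nat n * \<tau> \<in> \<int>"
      by (simp only: expi_eq_1_iff [symmetric] expi_add expi_of_nat_mult)
    then obtain j :: int where "\<tau> - z + of_nat n * \<tau> = of_int j"
      by (auto elim: Ints_cases)
    then have "z = of_int (1 + int n) * \<tau> + of_int (- j)"
      by (simp add: algebra_simps)
    then show ?thesis by blast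
  qed
next
  note q = norm_expi_less_1 [OF assms]
  have "\<exists>n. expi \<tau> ^ n = 1" by (rule exI [of _ 0]) simp
  then have "theta 0 \<tau> = 0"
    by (simp add: theta_def qpoch_eq_0_iff [OF q])
  moreover assume "\<exists>m n :: int. z = of_int m * \<tau> + of_int n"
  ultimately show "theta z \<tau> = 0"
    using theta_shift [OF assms, of 0] by auto
qed

lemma holomorphic_on_theta:
  assumes "Im \<tau> > 0" "f holomorphic_on S" "open S"
  shows "(\<lambda>z. theta (f z) \<tau>) holomorphic_on S"
  unfolding theta_def
  by (intro holomorphic_intros holomorphic_on_qpoch assms)
     (use norm_expi_less_1 [OF assms(1)] euler_prod_nonzero in auto)

lemma theta_has_field_derivative_0:
  assumes "Im \<tau> > 0"
  shows "((\<lambda>z. theta z \<tau>) has_field_derivative 2 * of_real pi * \<i>) (at 0)"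
proof -
  note q = norm_expi_less_1 [OF assms]
  \<comment> \<open>\<open>g\<close> is theta without the factor \<open>1 - expi z\<close>, which
    vanishes at 0; the derivative of theta at 0 therefore depends on \<open>g 0 = - 1\<close>
    alone.\<close>
  define g where "g z = - expi (- z / 2) * qpoch (expi z * expi \<tau>) (expi \<tau>)
    * qpoch (expi (\<tau> - z)) (expi \<tau>) / euler_prod (expi \<tau>) ^ 2" for z
  have eq: "theta z \<tau> = (1 - expi z) * g z" for z
    unfolding theta_def g_def by (subst qpoch_rec [OF q]) simp
  have "g holomorphic_on UNIV"
    unfolding g_def by (intro holomorphic_intros holomorphic_on_qpoch)
      (use q euler_prod_nonzero in auto)
  then obtain g' where g': "(g has_field_derivative g') (at 0)"
    by (meson UNIV_I holomorphic_on_def field_differentiable_def has_field_derivative_at_within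
        at_within_open open_UNIV)
  have "g 0 = - 1"
    using euler_prod_nonzero [OF q] by (simp add: g_def euler_prod_def power2_eq_square)
  moreover have "((\<lambda>z. (1 - expi z) * g z) has_field_derivative - (2 * of_real pi * \<i>) * g 0) (at 0)"
    by (rule derivative_eq_intros g' refl)+ simp
  ultimately show ?thesis
    unfolding eq by simp
qed

text \<open>The quotient of \<open>W\<close> by theta is elliptic without poles. Instead of extending it to the plane, we
  apply the maximum modulus principle on the open doubled period cell \<open>U\<close>: by periodicity the maximum
  over \<open>U\<close> is attained on the compact cell \<open>K\<close> inside it.\<close>

lemma theta_quasi_periodic_unique:
  assumes \<tau>: "Im \<tau> > 0" and holW: "W holomorphic_on UNIV" and "W 0 = 0"
    and shift: "\<And>z m n. W (z + (of_int m * \<tau> + of_int n)) =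
      expi ((of_int m + of_int n) / 2 - of_int m * z - of_int m ^ 2 * \<tau> / 2) * W z"
  shows "W z = deriv W 0 / (2 * of_real pi * \<i>) * theta z \<tau>"
proof -
  \<comment> \<open>\<open>s\<close> and \<open>t\<close> are the real coordinates of a point in the
    basis \<open>\<tau>\<close>, 1; lattice translations act on them by integers.\<close>
  define s where "s z = Im z / Im \<tau>" for z
  define t where "t z = Re z - s z * Re \<tau>" for z
  have z_eq: "z = of_real (s z) * \<tau> + of_real (t z)" for z
    using \<tau> by (intro complex_eqI) (auto simp: s_def t_def)
  have s_shift: "s (z + (of_int m * \<tau> + of_int n)) = s z + of_int m" for z m n
    using \<tau> by (simp add: s_def field_simps)
  have t_shift: "t (z + (of_int m * \<tau> + of_int n)) = t z + of_int n" for z m n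
    unfolding t_def s_shift by (simp add: algebra_simps)
  have [simp]: "s 0 = 0" "t 0 = 0"
    by (auto simp: s_def t_def)
  have lin: "linear s" "linear t"
    by (auto simp: linear_iff s_def t_def add_divide_distrib algebra_simps)
  have conts: "continuous_on UNIV s" "continuous_on UNIV t"
    unfolding t_def s_def by (intro continuous_intros | use \<tau> in auto)+
  \<comment> \<open>The only lattice point in \<open>U\<close> is 0, while rounding both coordinates
    moves any point of the plane into \<open>K\<close>.\<close>
  define U where "U = s -` {-1<..<1} \<inter> t -` {-1<..<1}"
  define K where "K = s -` {-1/2..1/2} \<inter> t -` {-1/2..1/2}"
  have "K \<subseteq> U" "0 \<in> K"
    by (auto simp: K_def U_def)
  have "open U"
    unfolding U_def by (intro open_Int open_vimage conts) auto
  have "connected U"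
    unfolding U_def by (intro convex_connected convex_Int convex_linear_vimage lin) auto
  have "compact K"
  proof -
    have "norm z \<le> norm \<tau> + 1" if "z \<in> K" for z
    proof -
      have "norm z \<le> \<bar>s z\<bar> * norm \<tau> + \<bar>t z\<bar>"
        using z_eq [of z] norm_triangle_ineq [of "of_real (s z) * \<tau>" "of_real (t z)"]
        by (simp add: norm_mult)
      also have "\<dots> \<le> 1 * norm \<tau> + 1"
        using that by (intro add_mono mult_right_mono) (auto simp: K_def)
      finally show ?thesis by simp
    qed
    then have "bounded K"
      by (auto simp: bounded_iff)
    moreover have "closed K"
      unfolding K_def by (intro closed_Int closed_vimage conts) auto
    ultimately show ?thesis
      using compact_eq_bounded_closed by blast
  qed
  have reduce: "\<exists>k m n. k \<in> K \<and> z = k + (of_int m * \<tau> + of_int n)" for z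
  proof -
    define k where "k = z + (of_int (- round (s z)) * \<tau> + of_int (- round (t z)))"
    have "k \<in> K"
    proof -
      have "s k = s z - of_int (round (s z))" "t k = t z - of_int (round (t z))"
        unfolding k_def s_shift t_shift by simp_all
      then have "\<bar>s k\<bar> \<le> 1 / 2" "\<bar>t k\<bar> \<le> 1 / 2"
        using of_int_round_abs_le [of "s z"] of_int_round_abs_le [of "t z"] by linarith+
      then show ?thesis
        by (auto simp: K_def abs_le_iff)
    qed
    moreover have "z = k + (of_int (round (s z)) * \<tau> + of_int (round (t z)))"
      by (simp add: k_def)
    ultimately show ?thesis by blast
  qed
  define \<Theta> where "\<Theta> z = theta z \<tau>" for z
  have \<Theta>_shift: "\<Theta> (z + (of_int m * \<tau> + of_int n)) =
      expi ((of_int m + of_int n) / 2 - of_int m * z - of_int m ^ 2 * \<tau> / 2) * \<Theta> z" for z m n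
    using theta_shift [OF \<tau>, of z m n] by (simp add: \<Theta>_def add.assoc)
  have \<Theta>0: "\<Theta> 0 = 0"
    unfolding \<Theta>_def theta_eq_0_iff [OF \<tau>] by (intro exI [of _ 0]) auto
  have \<Theta>_nz: "\<Theta> z \<noteq> 0" if z: "z \<in> U" "z \<noteq> 0" for z
  proof
    assume "\<Theta> z = 0"
    then obtain m n :: int where mn: "z = of_int m * \<tau> + of_int n"
      by (auto simp: \<Theta>_def theta_eq_0_iff [OF \<tau>])
    then have "s z = of_int m" "t z = of_int n"
      using s_shift [of 0 m n] t_shift [of 0 m n] by auto
    then have "m = 0" "n = 0"
      using z by (auto simp: U_def)
    then show False using mn z by simp
  qed
  have hol\<Theta>: "\<Theta> holomorphic_on UNIV"
    unfolding \<Theta>_def by (intro holomorphic_on_theta \<tau>) auto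
  have deriv\<Theta>: "deriv \<Theta> 0 = 2 * of_real pi * \<i>"
    unfolding \<Theta>_def by (rule DERIV_imp_deriv [OF theta_has_field_derivative_0 [OF \<tau>]])
  \<comment> \<open>Both functions vanish at 0 and are divided by \<open>z\<close> there. The zero
    of theta is simple, since its derivative is nonzero, so \<open>\<Theta>1\<close> has no zero on
    \<open>U\<close>.\<close>
  define W1 where "W1 z = (if z = 0 then deriv W 0 else W z / z)" for z
  define \<Theta>1 where "\<Theta>1 z = (if z = 0 then deriv \<Theta> 0 else \<Theta> z / z)" for z
  have "W1 holomorphic_on UNIV" "\<Theta>1 holomorphic_on UNIV"
    by (rule pole_theorem_open_0 [of W UNIV 0], auto simp: W1_def holW \<open>W 0 = 0\<close>)
       (rule pole_theorem_open_0 [of \<Theta> UNIV 0], auto simp: \<Theta>1_def hol\<Theta> \<Theta>0)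
  moreover have "\<Theta>1 z \<noteq> 0" if "z \<in> U" for z
    using that \<Theta>_nz [of z] by (auto simp: \<Theta>1_def deriv\<Theta>)
  ultimately have hol: "(\<lambda>z. W1 z / \<Theta>1 z) holomorphic_on U"
    by (intro holomorphic_intros) (auto intro: holomorphic_on_subset)
  then have "continuous_on K (\<lambda>z. norm (W1 z / \<Theta>1 z))"
    by (rule continuous_on_norm [OF continuous_on_subset
          [OF holomorphic_on_imp_continuous_on \<open>K \<subseteq> U\<close>]])
  then obtain \<xi> where \<xi>: "\<xi> \<in> K" "\<And>z. z \<in> K \<Longrightarrow> norm (W1 z / \<Theta>1 z) \<le> norm (W1 \<xi> / \<Theta>1 \<xi>)"
    using continuous_attains_sup [OF \<open>compact K\<close>, of "\<lambda>z. norm (W1 z / \<Theta>1 z)"] \<open>0 \<in> K\<close> by blast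
  have "norm (W1 z / \<Theta>1 z) \<le> norm (W1 \<xi> / \<Theta>1 \<xi>)" if "z \<in> U" for z
  proof (cases "z = 0")
    case True
    then show ?thesis using \<xi>(2) \<open>0 \<in> K\<close> by blast
  next
    case False
    obtain k m n where k: "k \<in> K" "z = k + (of_int m * \<tau> + of_int n)"
      using reduce by blast
    \<comment> \<open>If \<open>k\<close> were 0, then \<open>z\<close> would be a lattice point and
      a zero of \<open>\<Theta>\<close> in \<open>U\<close> other than 0.\<close>
    have "k \<noteq> 0"
      using k(2) \<Theta>_shift [of 0 m n] \<Theta>0 \<Theta>_nz [OF that False] by auto
    have "W1 z / \<Theta>1 z = W z / \<Theta> z"
      using False by (simp add: W1_def \<Theta>1_def)
    also have "\<dots> = W k / \<Theta> k"
      unfolding k(2) shift \<Theta>_shift by simp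
    also have "\<dots> = W1 k / \<Theta>1 k"
      using \<open>k \<noteq> 0\<close> by (simp add: W1_def \<Theta>1_def)
    finally show ?thesis using \<xi>(2) [OF k(1)] by simp
  qed
  then have "(\<lambda>z. W1 z / \<Theta>1 z) constant_on U"
    using maximum_modulus_principle [OF hol \<open>open U\<close> \<open>connected U\<close> \<open>open U\<close> order_refl, of \<xi>]
      \<xi>(1) \<open>K \<subseteq> U\<close> by blast
  have const: "W1 z / \<Theta>1 z = deriv W 0 / deriv \<Theta> 0" if "z \<in> U" for z
  proof -
    have "W1 z / \<Theta>1 z = W1 0 / \<Theta>1 0"
      using \<open>(\<lambda>z. W1 z / \<Theta>1 z) constant_on U\<close> that \<open>K \<subseteq> U\<close> \<open>0 \<in> K\<close>
      unfolding constant_on_def by auto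
    then show ?thesis by (simp add: W1_def \<Theta>1_def)
  qed
  obtain k m n where k: "k \<in> K" "z = k + (of_int m * \<tau> + of_int n)"
    using reduce by blast
  have "W k = deriv W 0 / deriv \<Theta> 0 * \<Theta> k"
  proof (cases "k = 0")
    case True
    then show ?thesis using \<open>W 0 = 0\<close> \<Theta>0 by simp
  next
    case False
    with const [of k] \<Theta>_nz [of k] k \<open>K \<subseteq> U\<close> show ?thesis
      by (auto simp: W1_def \<Theta>1_def divide_simps mult_ac)
  qed
  then have "W z = deriv W 0 / deriv \<Theta> 0 * \<Theta> z"
    unfolding k(2) shift \<Theta>_shift by simp
  then show ?thesis
    unfolding deriv\<Theta> by (simp add: \<Theta>_def)
qed

section \<open>Modular transformation of theta\<close>

lemma moebius_denominator_nonzero: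
  fixes a b c d :: int
  assumes "a * d - b * c = 1" "Im \<tau> > 0"
  shows "of_int c * \<tau> + of_int d \<noteq> 0"
proof
  assume *: "of_int c * \<tau> + of_int d = 0"
  then have "Im (of_int c * \<tau> + of_int d) = 0" by (simp only: zero_complex.simps)
  then have "c = 0" using assms by simp
  with * have "d = 0" by simp
  with \<open>c = 0\<close> assms show False by simp
qed

lemma Im_moebius:
  fixes a b c d :: int
  assumes "a * d - b * c = 1"
  shows "Im ((of_int a * \<tau> + of_int b) / (of_int c * \<tau> + of_int d)) =
         Im \<tau> / norm (of_int c * \<tau> + of_int d) ^ 2"
proof -
  have "real_of_int (a * d - b * c) = 1" using assms by simp
  then have "Im \<tau> = Im \<tau> * (real_of_int a * real_of_int d - real_of_int b * real_of_int c)" by simp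
  then show ?thesis
    unfolding Im_divide cmod_power2
    by (simp add: algebra_simps)
qed

text \<open>After multiplication by a Gaussian factor, the left side has the same quasi-periods in
  \<open>z\<close> as \<open>theta z \<tau>\<close> and vanishes at 0. By
  \<open>theta_quasi_periodic_unique\<close> the two are proportional, and comparing derivatives at
  0 gives the constant 1/j.\<close>

lemma theta_modular:
  fixes a b c d :: int
  assumes det: "a * d - b * c = 1" and \<tau>: "Im \<tau> > 0"
  defines "j \<equiv> of_int c * \<tau> + of_int d" and "\<sigma> \<equiv> (of_int a * \<tau> + of_int b) / (of_int c * \<tau> + of_int d)"
  shows "theta (z / j) \<sigma> = expi (of_int c * z ^ 2 / (2 * j)) / j * theta z \<tau>"
proof -
  have j: "j \<noteq> 0"
    unfolding j_def by (rule moebius_denominator_nonzero [OF det \<tau>])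
  have \<sigma>: "Im \<sigma> > 0"
    using Im_moebius [OF det, of \<tau>] \<tau> j unfolding \<sigma>_def j_def [symmetric] by simp
  have detc: "of_int a * of_int d - of_int b * of_int c = (1 :: complex)"
    using arg_cong [OF det, of complex_of_int] by simp
  have j\<sigma>: "j * \<sigma> = of_int a * \<tau> + of_int b"
    using j by (simp add: \<sigma>_def j_def)
  define W where "W z = theta (z / j) \<sigma> * expi (- of_int c * z ^ 2 / (2 * j))" for z
  have "W (z + (of_int m * \<tau> + of_int n)) =
      expi ((of_int m + of_int n) / 2 - of_int m * z - of_int m ^ 2 * \<tau> / 2) * W z" for z m n
  proof -
    \<comment> \<open>\<open>M\<close> and \<open>L\<close> are the coordinates of
      \<open>v / j\<close> in the lattice spanned by \<open>\<sigma>\<close> and 1, obtained from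
      the inverse matrix.\<close>
    define M where "M = m * d - n * c"
    define L where "L = n * a - m * b"
    define v where "v = of_int m * \<tau> + of_int n"
    have v: "v = j * (of_int M * \<sigma> + of_int L)"
    proof -
      have "j * (of_int M * \<sigma> + of_int L) = of_int M * (j * \<sigma>) + j * of_int L"
        by (simp add: algebra_simps)
      also have "\<dots> = (of_int a * of_int d - of_int b * of_int c) * v"
        unfolding j\<sigma> M_def L_def v_def by (simp add: j_def algebra_simps)
      finally show ?thesis using detc by simp
    qed
    have cv: "of_int c * v = of_int m * j - of_int M"
      by (simp add: v_def M_def j_def algebra_simps)
    have arg: "(z + v) / j = z / j + of_int M * \<sigma> + of_int L"
      using j v by (simp add: field_simps)
    \<comment> \<open>m + n + m n is even exactly if \<open>m\<close> and \<open>n\<close> both are.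
      A matrix of odd determinant preserves this property, so the signs in the two quasi-periodicity
      laws agree.\<close>
    have "even (M + L + M * L - (m + n + m * n))"
    proof -
      have "odd (a * d - b * c)" using det by simp
      then show ?thesis
        unfolding M_def L_def
        by (cases "even a"; cases "even b"; cases "even c"; cases "even d"; cases "even m";
            cases "even n"; simp)
    qed
    then obtain e where "M + L + M * L - (m + n + m * n) = 2 * e"
      by (elim evenE)
    then have e: "M + L + M * L = m + n + m * n + 2 * e"
      by linarith
    have ec: "of_int M + of_int L + of_int M * of_int L =
        (of_int m + of_int n + of_int m * of_int n + 2 * of_int e :: complex)"
      using arg_cong [OF e, of complex_of_int] by simp
    have quad: "of_int c * v ^ 2 / j = of_int m * v - of_int M ^ 2 * \<sigma> - of_int M * of_int L"
    proof -
      have "of_int c * v ^ 2 / j = (of_int c * v) * (v / j)"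
        by (simp add: power2_eq_square)
      also have "\<dots> = (of_int m * j - of_int M) * (of_int M * \<sigma> + of_int L)"
        unfolding cv using j v by simp
      also have "\<dots> = of_int m * (j * (of_int M * \<sigma> + of_int L)) - of_int M ^ 2 * \<sigma> - of_int M * of_int L"
        by (simp add: algebra_simps power2_eq_square)
      finally show ?thesis using v by simp
    qed
    have lin: "of_int c * v / j = of_int m - of_int M / j"
      unfolding cv using j by (simp add: field_simps)
    have expo: "of_int c * (z + v) ^ 2 / (2 * j) =
        of_int c * z ^ 2 / (2 * j) + (of_int c * v / j) * z + (of_int c * v ^ 2 / j) / 2"
      by (simp add: power2_eq_square ring_distribs add_divide_distrib mult_ac)
    have "W (z + v) = expi ((of_int M + of_int L) / 2 - of_int M * (z / j) - of_int M ^ 2 * \<sigma> / 2)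
        * theta (z / j) \<sigma> * expi (- (of_int c * (z + v) ^ 2 / (2 * j)))"
      unfolding W_def arg theta_shift [OF \<sigma>] by (simp only: minus_divide_left minus_mult_left)
    also have "\<dots> = expi ((of_int M + of_int L) / 2 - of_int M * (z / j) - of_int M ^ 2 * \<sigma> / 2
          - of_int c * (z + v) ^ 2 / (2 * j)) * theta (z / j) \<sigma>"
      by (simp only: expi_diff expi_minus divide_inverse mult_ac)
    also have "expi ((of_int M + of_int L) / 2 - of_int M * (z / j) - of_int M ^ 2 * \<sigma> / 2
          - of_int c * (z + v) ^ 2 / (2 * j)) =
        expi ((of_int m + of_int n) / 2 - of_int m * z - of_int m ^ 2 * \<tau> / 2
          + - of_int c * z ^ 2 / (2 * j))"
    proof (rule expi_cong_Ints)
      have "(of_int M + of_int L) / 2 - of_int M * (z / j) - of_int M ^ 2 * \<sigma> / 2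
          - of_int c * (z + v) ^ 2 / (2 * j) -
        ((of_int m + of_int n) / 2 - of_int m * z - of_int m ^ 2 * \<tau> / 2
          + - of_int c * z ^ 2 / (2 * j)) =
        (of_int M + of_int L + of_int M * of_int L - of_int m * v - of_int m - of_int n
          + of_int m ^ 2 * \<tau>) / 2"
        unfolding expo quad lin by (simp add: ring_distribs add_divide_distrib diff_divide_distrib)
      also have "\<dots> = of_int e"
        unfolding ec by (simp add: v_def field_simps power2_eq_square)
      finally show "(of_int M + of_int L) / 2 - of_int M * (z / j) - of_int M ^ 2 * \<sigma> / 2
          - of_int c * (z + v) ^ 2 / (2 * j) -
        ((of_int m + of_int n) / 2 - of_int m * z - of_int m ^ 2 * \<tau> / 2
          + - of_int c * z ^ 2 / (2 * j)) \<in> \<int>"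
        by (simp only: Ints_of_int)
    qed
    finally show ?thesis
      unfolding W_def v_def by (simp only: expi_add mult_ac)
  qed
  moreover have "W holomorphic_on UNIV"
    unfolding W_def by (intro holomorphic_intros holomorphic_on_theta \<sigma>) (use j in auto)
  moreover have "theta 0 \<sigma> = 0"
    unfolding theta_eq_0_iff [OF \<sigma>] by (intro exI [of _ 0]) auto
  then have "W 0 = 0"
    by (simp add: W_def)
  moreover have "deriv W 0 = 2 * of_real pi * \<i> / j"
  proof (rule DERIV_imp_deriv)
    have *: "((\<lambda>z. z / j) has_field_derivative 1 / j) (at 0)"
      by (rule DERIV_cdivide [OF DERIV_ident])
    have 1: "((\<lambda>z. theta (z / j) \<sigma>) has_field_derivative 2 * of_real pi * \<i> * (1 / j)) (at 0)"
      using DERIV_chain2 [of "\<lambda>z. theta z \<sigma>" "2 * of_real pi * \<i>" "\<lambda>z. z / j" 0 "1 / j" UNIV, OF _ *]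
        theta_has_field_derivative_0 [OF \<sigma>] by simp
    \<comment> \<open>The value \<open>D\<close> of this derivative is left open, because the
      product rule multiplies it by \<open>theta 0 \<sigma> = 0\<close>.\<close>
    have "(\<lambda>z. expi (- of_int c * z ^ 2 / (2 * j))) holomorphic_on UNIV"
      using j by (intro holomorphic_intros) auto
    then obtain D where 2: "((\<lambda>z. expi (- of_int c * z ^ 2 / (2 * j))) has_field_derivative D) (at 0)"
      by (metis UNIV_I field_differentiable_def holomorphic_on_def)
    show "(W has_field_derivative 2 * of_real pi * \<i> / j) (at 0)"
      unfolding W_def using DERIV_mult [OF 1 2] \<open>theta 0 \<sigma> = 0\<close> by simp
  qed
  ultimately have "W z = theta z \<tau> / j"
    using theta_quasi_periodic_unique [OF \<tau>, of W z] by simp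
  then have "theta (z / j) \<sigma> = theta z \<tau> / j / expi (- of_int c * z ^ 2 / (2 * j))"
    unfolding W_def by (simp only: nonzero_eq_divide_eq [OF expi_nonzero])
  also have "- of_int c * z ^ 2 / (2 * j) = - (of_int c * z ^ 2 / (2 * j))"
    by simp
  finally show ?thesis
    by (simp only: expi_minus divide_inverse inverse_inverse_eq mult_ac)
qed

subsection \<open>Klein forms and the modularity of eta\<close>

text \<open>The exponential factor cancels the one in the transformation of theta: \<open>SL\<^sub>2(\<int>)\<close> then acts by weight
  \<open>-1\<close> and on the row vector \<open>(x, y)\<close>.\<close>

definition klein :: "complex \<Rightarrow> complex \<Rightarrow> complex \<Rightarrow> complex" where
  "klein x y \<tau> = expi (x * (x * \<tau> + y) / 2) * theta (x * \<tau> + y) \<tau>"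

text \<open>With w the new argument, the determinant condition gives x' j = x + c w. Hence the
  exponent x w / (2 j) of the Klein form and the exponent c w^2 / (2 j) from theta combine to x' w /
  2, the exponent of the Klein form at the new row vector.\<close>

lemma klein_modular:
  fixes a b c d :: int
  assumes det: "a * d - b * c = 1" and \<tau>: "Im \<tau> > 0"
  shows "klein x y ((of_int a * \<tau> + of_int b) / (of_int c * \<tau> + of_int d)) =
         klein (x * of_int a + y * of_int c) (x * of_int b + y * of_int d) \<tau> / (of_int c * \<tau> + of_int d)"
proof -
  define j where "j = of_int c * \<tau> + of_int d"
  define \<sigma> where "\<sigma> = (of_int a * \<tau> + of_int b) / (of_int c * \<tau> + of_int d)"
  define x' where "x' = x * of_int a + y * of_int c"
  define w where "w = x' * \<tau> + (x * of_int b + y * of_int d)"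
  have j: "j \<noteq> 0"
    unfolding j_def by (rule moebius_denominator_nonzero [OF det \<tau>])
  have detc: "of_int a * of_int d = 1 + of_int b * (of_int c :: complex)"
    using arg_cong [OF det, of complex_of_int] by (simp add: algebra_simps)
  have j\<sigma>: "j * \<sigma> = of_int a * \<tau> + of_int b"
    using j by (simp add: \<sigma>_def j_def)
  have "j * (x * \<sigma> + y) = x * (j * \<sigma>) + j * y"
    by (simp add: algebra_simps)
  also have "\<dots> = w"
    unfolding j\<sigma> w_def x'_def by (simp add: j_def algebra_simps)
  finally have z: "x * \<sigma> + y = w / j"
    using j by (simp add: field_simps)
  have "x' * j = x' * of_int c * \<tau> + x * (of_int a * of_int d) + y * of_int c * of_int d"
    by (simp add: j_def x'_def algebra_simps)
  also have "\<dots> = x + of_int c * w"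
    unfolding detc by (simp add: w_def algebra_simps)
  finally have xj: "x' * j = x + of_int c * w" .
  have "x * (w / j) / 2 + of_int c * w ^ 2 / (2 * j) = (x + of_int c * w) * w / (2 * j)"
    by (simp add: add_divide_distrib power2_eq_square ring_distribs mult_ac)
  also have "\<dots> = x' * w / 2"
    using j by (simp add: xj [symmetric])
  finally have expo: "x * (w / j) / 2 + of_int c * w ^ 2 / (2 * j) = x' * w / 2" .
  have "klein x y \<sigma> = expi (x * (w / j) / 2) * theta (w / j) \<sigma>"
    by (simp only: klein_def z)
  also have "theta (w / j) \<sigma> = expi (of_int c * w ^ 2 / (2 * j)) / j * theta w \<tau>"
    unfolding j_def \<sigma>_def by (rule theta_modular [OF det \<tau>])
  also have "expi (x * (w / j) / 2) * (expi (of_int c * w ^ 2 / (2 * j)) / j * theta w \<tau>) =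
      expi (x * (w / j) / 2 + of_int c * w ^ 2 / (2 * j)) * theta w \<tau> / j"
    by (simp add: expi_add)
  also have "\<dots> = klein x' (x * of_int b + y * of_int d) \<tau> / j"
    unfolding expo unfolding klein_def w_def ..
  finally show ?thesis
    by (simp only: \<sigma>_def j_def x'_def)
qed

text \<open>At rational points the factor is a root of unity, so a Klein form at a torsion point
  depends on the class of the point modulo the lattice up to a root of unity.\<close>

lemma klein_shift:
  assumes "Im \<tau> > 0"
  shows "klein (x + of_int m) (y + of_int n) \<tau> =
         expi ((of_int m + of_int n + of_int m * of_int n) / 2 + (x * of_int n - of_int m * y) / 2)
           * klein x y \<tau>"
proof -
  define z where "z = x * \<tau> + y"
  have z: "(x + of_int m) * \<tau> + (y + of_int n) = z + of_int m * \<tau> + of_int n"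
    by (simp add: z_def algebra_simps)
  have "klein (x + of_int m) (y + of_int n) \<tau> =
      expi ((x + of_int m) * (z + of_int m * \<tau> + of_int n) / 2 +
        ((of_int m + of_int n) / 2 - of_int m * z - of_int m ^ 2 * \<tau> / 2)) * theta z \<tau>"
    unfolding klein_def z theta_shift [OF assms] by (simp add: expi_add)
  also have "(x + of_int m) * (z + of_int m * \<tau> + of_int n) / 2 +
        ((of_int m + of_int n) / 2 - of_int m * z - of_int m ^ 2 * \<tau> / 2) =
      ((of_int m + of_int n + of_int m * of_int n) / 2 + (x * of_int n - of_int m * y) / 2) + x * z / 2"
    unfolding z_def by (simp add: field_simps power2_eq_square)
  finally show ?thesis
    unfolding klein_def z_def [symmetric] by (simp add: expi_add mult_ac)
qed

section \<open>Products of Klein forms at 2-torsion points, and the 24th power of eta\<close>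

text \<open>Both sides are polynomials in \<open>X\<close> of degree at most \<open>p\<close> that
  agree at the p-th roots of unity. The point 0 is added as agreement number p + 1, in place of a
  comparison of leading coefficients.\<close>

lemma prod_one_minus_roots_unity:
  fixes X :: complex
  assumes "p > 0"
  shows "(\<Prod>j<p. 1 - expi (of_nat j / of_nat p) * X) = 1 - X ^ p"
proof -
  define A where "A = insert 0 ((\<lambda>j. expi (- (of_nat j / of_nat p))) ` {..<p})"
  define P where "P = (\<Prod>j<p. [:1, - expi (of_nat j / of_nat p):])"
  have "inj_on (\<lambda>j. expi (- (of_nat j / of_nat p))) {..<p}"
  proof (rule linorder_inj_onI)
    fix i j :: nat assume ij: "i < j" "i \<in> {..<p}" "j \<in> {..<p}"
    show "expi (- (of_nat i / of_nat p)) \<noteq> expi (- (of_nat j / of_nat p))"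
    proof
      assume "expi (- (of_nat i / of_nat p)) = expi (- (of_nat j / of_nat p))"
      then have "expi (- (of_nat i / of_nat p) - - (of_nat j / of_nat p)) = 1"
        by (simp only: expi_diff) simp
      then have "of_nat j / of_nat p - of_nat i / of_nat p \<in> (\<int> :: complex set)"
        by (simp add: expi_eq_1_iff)
      then obtain k :: int where "of_nat j / of_nat p - of_nat i / of_nat p = (of_int k :: complex)"
        by (auto elim: Ints_cases)
      then have "of_nat j - of_nat i = (of_int k * of_nat p :: complex)"
        using assms by (simp add: field_simps)
      then have "of_int (int j - int i) = (of_int (k * int p) :: complex)"
        by simp
      then have "int j - int i = k * int p"
        by (simp only: of_int_eq_iff)
      moreover have "0 < int j - int i" "int j - int i < int p"
        using ij by auto
      ultimately show False
        by (metis dvd_triv_right zdvd_not_zless)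
    qed
  qed auto
  then have "card A = Suc p"
    unfolding A_def by (subst card_insert_disjoint) (auto simp: card_image dest: sym)
  have "degree P \<le> p"
    unfolding P_def
    by (rule order_trans [OF degree_prod_sum_le])
       (auto intro: order_trans [OF sum_mono [of _ _ "\<lambda>_. 1"]])
  have "poly P x = poly (1 - monom 1 p) x" if x: "x \<in> A" for x
  proof (cases "x = 0")
    case True
    then show ?thesis using assms by (simp add: P_def poly_prod poly_monom)
  next
    case False
    then obtain j where j: "j < p" "x = expi (- (of_nat j / of_nat p))"
      using x by (auto simp: A_def)
    have "x ^ p = expi (of_nat p * (- (of_nat j / of_nat p)))"
      unfolding j(2) by (simp only: expi_of_nat_mult)
    also have "of_nat p * (- (of_nat j / of_nat p)) = (of_int (- int j) :: complex)"
      using assms by simp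
    finally have "x ^ p = 1" by (simp only: expi_of_int)
    moreover have "poly P x = 0"
      unfolding P_def poly_prod using j by (auto simp: expi_minus intro!: bexI [of _ j])
    ultimately show ?thesis by (simp add: poly_monom)
  qed
  moreover have "degree (1 - monom (1 :: complex) p) \<le> p"
    by (intro degree_diff_le) (auto simp: degree_monom_le)
  ultimately have "P = 1 - monom 1 p"
    using \<open>card A = Suc p\<close> \<open>degree P \<le> p\<close> by (intro poly_eqI_degree [of A]) auto
  then have "poly P X = poly (1 - monom 1 p) X" by simp
  then show ?thesis
    by (simp add: P_def poly_prod poly_monom mult.commute)
qed

lemma prod_qpoch_roots_unity:
  assumes "norm q < 1" "p > 0"
  shows "(\<Prod>j<p. qpoch (expi (of_nat j / of_nat p) * w) q) = qpoch (w ^ p) (q ^ p)"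
proof (rule LIMSEQ_unique)
  show "(\<lambda>N. \<Prod>j<p. \<Prod>n<N. 1 - expi (of_nat j / of_nat p) * w * q ^ n)
      \<longlonglongrightarrow> (\<Prod>j<p. qpoch (expi (of_nat j / of_nat p) * w) q)"
    by (intro tendsto_prod qpoch_LIMSEQ assms)
  have "(\<Prod>j<p. \<Prod>n<N. 1 - expi (of_nat j / of_nat p) * w * q ^ n)
      = (\<Prod>n<N. 1 - w ^ p * (q ^ p) ^ n)" for N
  proof -
    have "(\<Prod>j<p. \<Prod>n<N. 1 - expi (of_nat j / of_nat p) * w * q ^ n)
        = (\<Prod>n<N. \<Prod>j<p. 1 - expi (of_nat j / of_nat p) * (w * q ^ n))"
      by (subst prod.swap) (simp add: mult.assoc)
    then show ?thesis
      unfolding prod_one_minus_roots_unity [OF assms(2)]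
      by (simp add: power_mult_distrib power_mult [symmetric] mult.commute)
  qed
  moreover have "norm (q ^ p) < 1"
    unfolding norm_power using assms by (metis norm_ge_zero power_less_one_iff)
  ultimately show "(\<lambda>N. \<Prod>j<p. \<Prod>n<N. 1 - expi (of_nat j / of_nat p) * w * q ^ n)
      \<longlonglongrightarrow> qpoch (w ^ p) (q ^ p)"
    by (simp only:) (rule qpoch_LIMSEQ)
qed

lemma qpoch_split_even_odd:
  assumes "norm q < 1"
  shows "qpoch w q = qpoch w (q ^ 2) * qpoch (w * q) (q ^ 2)"
proof (rule LIMSEQ_unique)
  have q2: "norm (q ^ 2) < 1"
    unfolding norm_power using assms by (metis norm_ge_zero power_less_one_iff zero_less_numeral)
  have "strict_mono (\<lambda>N :: nat. 2 * N)"
    by (simp add: strict_mono_def)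
  then show "(\<lambda>N. \<Prod>n<2 * N. 1 - w * q ^ n) \<longlonglongrightarrow> qpoch w q"
    using LIMSEQ_subseq_LIMSEQ [OF qpoch_LIMSEQ [OF assms, of w]] by (simp add: o_def)
  have "(\<Prod>n<2 * N. 1 - w * q ^ n) =
      (\<Prod>n<N. 1 - w * (q ^ 2) ^ n) * (\<Prod>n<N. 1 - w * q * (q ^ 2) ^ n)" for N
    by (induction N) (simp_all add: power_mult [symmetric] mult_ac)
  then show "(\<lambda>N. \<Prod>n<2 * N. 1 - w * q ^ n) \<longlonglongrightarrow> qpoch w (q ^ 2) * qpoch (w * q) (q ^ 2)"
    by (simp only:) (intro tendsto_mult qpoch_LIMSEQ q2)
qed

text \<open>With r^2 = q this is the relation between the three Weber functions, stripped of powers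
  of q. After multiplication by the Euler product, pairing w with -w gives products with base q^2;
  these are the odd and even parts of the Euler product, which then cancels.\<close>

lemma qpoch_euler_identity:
  assumes "norm r < 1"
  shows "qpoch (- (r ^ 2)) (r ^ 2) * qpoch r (r ^ 2) * qpoch (- r) (r ^ 2) = 1"
proof -
  define q where "q = r ^ 2"
  have q: "norm q < 1"
    unfolding q_def norm_power using assms by (metis norm_ge_zero power_less_one_iff zero_less_numeral)
  have *: "qpoch w q * qpoch (- w) q = qpoch (w ^ 2) (q ^ 2)" for w
    using prod_qpoch_roots_unity [OF q, of 2 w] by (simp add: numeral_2_eq_2)
  have "qpoch q q * (qpoch (- q) q * qpoch r q * qpoch (- r) q) = qpoch q (q ^ 2) * qpoch (q ^ 2) (q ^ 2)"
    using * [of q] * [of r] by (simp add: q_def mult_ac)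
  also have "\<dots> = qpoch q q"
    using qpoch_split_even_odd [OF q, of q] by (simp add: power2_eq_square)
  finally show ?thesis
    using euler_prod_nonzero [OF q] by (simp add: euler_prod_def q_def)
qed

lemma dedekind_eta_nonzero: "Im \<tau> > 0 \<Longrightarrow> dedekind_eta \<tau> \<noteq> 0"
  by (simp add: dedekind_eta_eq euler_prod_nonzero norm_expi_less_1)

text \<open>At half-integral points the factor of \<open>klein_shift\<close> is a fourth root of
  unity.\<close>

lemma klein_half_power4_shift:
  assumes "Im \<tau> > 0"
  shows "klein (of_int m / 2) (of_int n / 2) \<tau> ^ 4 =
         klein (of_int (m mod 2) / 2) (of_int (n mod 2) / 2) \<tau> ^ 4"
proof -
  define u where "u = m div 2"
  define v where "v = n div 2"
  have mn: "m = m mod 2 + 2 * u" "n = n mod 2 + 2 * v"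
    by (simp_all add: u_def v_def)
  have x: "(of_int m / 2 :: complex) = of_int (m mod 2) / 2 + of_int u"
    by (subst mn(1)) (simp add: add_divide_distrib)
  have y: "(of_int n / 2 :: complex) = of_int (n mod 2) / 2 + of_int v"
    by (subst mn(2)) (simp add: add_divide_distrib)
  define t where "t = (of_int u + of_int v + of_int u * of_int v) / 2
      + (of_int (m mod 2) / 2 * of_int v - of_int u * (of_int (n mod 2) / 2)) / (2 :: complex)"
  have "expi t ^ 4 = expi (of_nat 4 * t)"
    by (simp only: expi_of_nat_mult)
  also have "of_nat 4 * t = of_int (2 * (u + v + u * v) + (m mod 2) * v - u * (n mod 2))"
    unfolding t_def by (simp add: field_simps)
  also have "expi \<dots> = 1" by (rule expi_of_int)
  finally show ?thesis
    unfolding x y klein_shift [OF assms] t_def [symmetric] by (simp add: power_mult_distrib)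
qed

text \<open>The infinite products other than powers of the Euler product cancel by
  \<open>qpoch_euler_identity\<close>, so the three Klein forms multiply to a constant times the
  power -6 of eta. Fourth powers are stated because only these depend on the torsion classes
  alone.\<close>

lemma klein_half_product:
  assumes "Im \<tau> > 0"
  shows "(klein (1 / 2) 0 \<tau> * klein 0 (1 / 2) \<tau> * klein (1 / 2) (1 / 2) \<tau>) ^ 4 * dedekind_eta \<tau> ^ 24 =
         (2 * expi (- 3 / 8)) ^ 4"
proof -
  define r where "r = expi (\<tau> / 2)"
  \<comment> \<open>In terms of \<open>s\<close> all fractional powers become integral: r = s^4, q =
    s^8, and \<open>s ^ 2 * E ^ 6\<close> is the sixth power of eta.\<close>
  define s where "s = expi (\<tau> / 8)"
  define q where "q = expi \<tau>"
  define E where "E = euler_prod q"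
  have r: "norm r < 1" using assms by (simp add: r_def norm_expi)
  have q: "norm q < 1" using assms by (simp add: q_def norm_expi)
  have qr: "q = r ^ 2"
    unfolding q_def r_def expi_of_nat_mult [symmetric] by simp
  have s: "r = s ^ 4"
    unfolding r_def s_def expi_of_nat_mult [symmetric] by (simp add: field_simps)
  have [simp]: "s \<noteq> 0" "E \<noteq> 0"
    using euler_prod_nonzero [OF q] by (auto simp: s_def E_def)
  have 1: "klein (1 / 2) 0 \<tau> = - inverse s * qpoch r q ^ 2 / E ^ 2"
  proof -
    have "expi (\<tau> / 8) * expi (- (\<tau> / 4)) = inverse s"
      unfolding expi_add [symmetric] s_def expi_minus [symmetric] by (simp add: field_simps)
    moreover have "expi (\<tau> - \<tau> / 2) = r"
      unfolding r_def by (simp add: field_simps)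
    ultimately show ?thesis
      unfolding klein_def theta_def
      by (simp add: q_def E_def r_def power2_eq_square mult.assoc [symmetric])
  qed
  have 2: "klein 0 (1 / 2) \<tau> = - 2 * expi (- 1 / 4) * qpoch (- q) q ^ 2 / E ^ 2"
  proof -
    have "expi (\<tau> - 1 / 2) = - q" by (simp add: expi_diff q_def)
    moreover have "qpoch (- 1) q = 2 * qpoch (- q) q"
      using qpoch_rec [OF q, of "- 1"] by simp
    ultimately show ?thesis
      unfolding klein_def theta_def
      by (simp add: q_def [symmetric] E_def power2_eq_square)
  qed
  have 3: "klein (1 / 2) (1 / 2) \<tau> = - expi (- 1 / 8) * inverse s * qpoch (- r) q ^ 2 / E ^ 2"
  proof -
    have "expi ((\<tau> / 2 + 1 / 2) / 4) * expi (- (\<tau> / 2 + 1 / 2) / 2) = expi (- 1 / 8) * inverse s"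
      unfolding expi_add [symmetric] s_def expi_minus [symmetric]
      by (rule arg_cong [where f = expi]) (simp add: field_simps)

    moreover have "expi (\<tau> / 2 + 1 / 2) = - r" by (simp add: expi_add r_def)
    moreover have "expi (\<tau> - (\<tau> / 2 + 1 / 2)) = - r"
    proof -
      have "expi (\<tau> - (\<tau> / 2 + 1 / 2)) = expi (\<tau> / 2 - 1 / 2)"
        by (rule arg_cong [where f = expi]) (simp add: field_simps)
      then show ?thesis by (simp add: expi_diff r_def)
    qed
    ultimately show ?thesis
      unfolding klein_def theta_def
      by (simp add: q_def [symmetric] E_def power2_eq_square)
  qed
  have eta: "dedekind_eta \<tau> ^ 24 = (s ^ 2 * E ^ 6) ^ 4"
  proof -
    have "expi (\<tau> / 24) ^ 24 = expi (of_nat 24 * (\<tau> / 24))"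
      by (simp only: expi_of_nat_mult)
    also have "\<dots> = q" by (simp add: q_def)
    also have "\<dots> = s ^ 8" by (simp add: qr s power_mult [symmetric])
    finally show ?thesis
      by (simp add: dedekind_eta_eq power_mult_distrib power_mult [symmetric] q_def E_def)
  qed
  have expis: "expi (- 1 / 4) * expi (- 1 / 8) = expi (- 3 / 8)"
    by (simp add: expi_add [symmetric])
  have "klein (1 / 2) 0 \<tau> * klein 0 (1 / 2) \<tau> * klein (1 / 2) (1 / 2) \<tau> * (s ^ 2 * E ^ 6) =
      - (2 * (expi (- 1 / 4) * expi (- 1 / 8))
          * (qpoch (- q) q * qpoch r q * qpoch (- r) q) ^ 2)"
    unfolding 1 2 3 by (simp add: power2_eq_square field_simps eval_nat_numeral)
  also have "\<dots> = - (2 * expi (- 3 / 8))"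
    using qpoch_euler_identity [OF r] unfolding expis qr by simp
  finally show ?thesis
    unfolding eta power_mult_distrib [symmetric] by simp
qed

text \<open>The matrix permutes the three nonzero classes of 2-torsion points, so the product of the
  fourth powers of their Klein forms has weight -12 without multiplier. By
  \<open>klein_half_product\<close> the 24th power of eta is a constant divided by that
  product.\<close>

lemma eta24_modular:
  fixes a b c d :: int
  assumes det: "a * d - b * c = 1" and \<tau>: "Im \<tau> > 0"
  shows "dedekind_eta ((of_int a * \<tau> + of_int b) / (of_int c * \<tau> + of_int d)) ^ 24 =
         (of_int c * \<tau> + of_int d) ^ 12 * dedekind_eta \<tau> ^ 24"
proof -
  define j where "j = of_int c * \<tau> + of_int d"
  define \<sigma> where "\<sigma> = (of_int a * \<tau> + of_int b) / (of_int c * \<tau> + of_int d)"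
  define k where "k m n \<tau> = klein (of_int m / 2) (of_int n / 2) \<tau> ^ 4" for m n \<tau>
  define P where "P \<tau> = k 1 0 \<tau> * k 0 1 \<tau> * k 1 1 \<tau>" for \<tau>
  have j: "j \<noteq> 0"
    unfolding j_def by (rule moebius_denominator_nonzero [OF det \<tau>])
  have \<sigma>: "Im \<sigma> > 0"
    using Im_moebius [OF det, of \<tau>] \<tau> j unfolding \<sigma>_def j_def [symmetric] by simp
  have k: "k m n \<sigma> = k (m * a + n * c) (m * b + n * d) \<tau> / j ^ 4" for m n
    unfolding k_def \<sigma>_def klein_modular [OF det \<tau>] j_def
    by (simp add: power_divide add_divide_distrib)
  have k_mod: "k m n \<tau> = k (m mod 2) (n mod 2) \<tau>" for m n
    unfolding k_def by (rule klein_half_power4_shift [OF \<tau>])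
  \<comment> \<open>The six cases are the elements of SL_2 over the field with two elements.\<close>
  have "odd (a * d - b * c)" using det by simp
  then consider "odd a" "odd d" "even b" "even c" | "odd a" "odd d" "odd b" "even c"
    | "odd a" "odd d" "even b" "odd c" | "even a" "odd d" "odd b" "odd c"
    | "odd a" "even d" "odd b" "odd c" | "even a" "even d" "odd b" "odd c"
    by auto
  then have "k a b \<tau> * k c d \<tau> * k (a + c) (b + d) \<tau> = P \<tau>"
    unfolding P_def k_mod [of a] k_mod [of c] k_mod [of "a + c"]
    by cases (simp_all add: mod2_eq_if)
  then have P: "P \<sigma> = P \<tau> / j ^ 12"
    unfolding P_def k by simp
  have eta: "P \<tau> * dedekind_eta \<tau> ^ 24 = (2 * expi (- 3 / 8)) ^ 4" if "Im \<tau> > 0" for \<tau>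
    using klein_half_product [OF that] by (simp add: P_def k_def power_mult_distrib)
  have "P \<tau> * (j ^ 12 * dedekind_eta \<tau> ^ 24) = P \<tau> * dedekind_eta \<sigma> ^ 24"
    using eta [OF \<tau>] eta [OF \<sigma>] j by (simp add: P field_simps)
  moreover have "P \<tau> \<noteq> 0"
    using eta [OF \<tau>] by auto
  ultimately show ?thesis
    by (simp add: j_def \<sigma>_def)
qed

section \<open>The quotient of eta(tau)^p by eta(p tau) on Gamma_1(p)\<close>

lemma sum_of_nat_formula: "2 * (\<Sum>j = 1..m. of_nat j) = (of_nat m * (of_nat m + 1) :: 'a :: comm_ring_1)"
  by (induction m) (simp_all add: algebra_simps)

lemma sum_of_nat_squares_formula:
  "6 * (\<Sum>j = 1..m. of_nat j ^ 2) = (of_nat m * (of_nat m + 1) * (2 * of_nat m + 1) :: 'a :: comm_ring_1)"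
  by (induction m) (simp_all add: algebra_simps power2_eq_square)

definition eta_ratio :: "nat \<Rightarrow> complex \<Rightarrow> complex" where
  "eta_ratio p \<tau> = dedekind_eta \<tau> ^ p / dedekind_eta (of_nat p * \<tau>)"

lemma eta_ratio_nonzero: "Im \<tau> > 0 \<Longrightarrow> p > 0 \<Longrightarrow> eta_ratio p \<tau> \<noteq> 0"
  by (simp add: eta_ratio_def dedekind_eta_nonzero)

text \<open>The two products in theta at j/p belong to the roots of unity with indices j and p - j,
  so all nontrivial p-th roots of unity occur exactly once. Adding the trivial root, which
  contributes the Euler product of q, yields the Euler product of q^p. The fractional powers of q
  cancel in \<open>eta_ratio\<close>.\<close>

lemma prod_klein_torsion:
  assumes "p = 2 * m + 1" and \<tau>: "Im \<tau> > 0"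
  shows "(\<Prod>j = 1..m. klein 0 (of_nat j / of_nat p) \<tau>) * eta_ratio p \<tau> =
         (\<Prod>j = 1..m. - expi (- (of_nat j / of_nat p) / 2) * (1 - expi (of_nat j / of_nat p)))"
proof -
  define q where "q = expi \<tau>"
  define E where "E = euler_prod q"
  define z where "z j = expi (of_nat j / of_nat p)" for j :: nat
  have q: "norm q < 1" using \<tau> by (simp add: q_def norm_expi)
  have p: "p > 0" using assms by simp
  have E: "E \<noteq> 0" unfolding E_def by (rule euler_prod_nonzero [OF q])
  have "norm (q ^ p) < 1"
    unfolding norm_power using q p by (metis norm_ge_zero power_less_one_iff)
  then have Ep: "euler_prod (q ^ p) \<noteq> 0"
    by (rule euler_prod_nonzero)
  have zrefl: "expi (\<tau> - of_nat j / of_nat p) = z (p - j) * q" if "j \<in> {1..m}" for j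
    unfolding q_def z_def expi_add [symmetric]
    by (rule expi_cong_Ints) (use that assms in \<open>auto simp: of_nat_diff diff_divide_distrib\<close>)
  have klein: "klein 0 (of_nat j / of_nat p) \<tau> =
      (- expi (- (of_nat j / of_nat p) / 2) * (1 - z j))
        * (qpoch (z j * q) q * qpoch (z (p - j) * q) q) / E ^ 2" if "j \<in> {1..m}" for j
    using qpoch_rec [OF q, of "z j"]
    by (simp add: klein_def theta_def zrefl [OF that] q_def [symmetric] E_def) (simp add: z_def)
  have "(\<Prod>j = 1..m. qpoch (z j * q) q * qpoch (z (p - j) * q) q) =
      (\<Prod>j = 1..m. qpoch (z j * q) q) * (\<Prod>j = 1..m. qpoch (z (p - j) * q) q)"
    by (rule prod.distrib)
  also have "(\<Prod>j = 1..m. qpoch (z (p - j) * q) q) = (\<Prod>j = m + 1..<p. qpoch (z j * q) q)"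
    by (rule prod.reindex_bij_witness [of _ "\<lambda>j. p - j" "\<lambda>j. p - j"]) (use assms in auto)
  also have "(\<Prod>j = 1..m. qpoch (z j * q) q) * (\<Prod>j = m + 1..<p. qpoch (z j * q) q) =
      (\<Prod>j \<in> {1..m} \<union> {m + 1..<p}. qpoch (z j * q) q)"
    by (subst prod.union_disjoint) auto
  also have "{1..m} \<union> {m + 1..<p} = {1..<p}"
    using assms by auto
  finally have pairs: "(\<Prod>j = 1..m. qpoch (z j * q) q * qpoch (z (p - j) * q) q) =
      (\<Prod>j = 1..<p. qpoch (z j * q) q)" .
  have "E * (\<Prod>j = 1..<p. qpoch (z j * q) q) = (\<Prod>j<p. qpoch (z j * q) q)"
    using p by (simp add: lessThan_atLeast0 prod.atLeast_Suc_lessThan E_def euler_prod_def z_def)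
  also have "\<dots> = euler_prod (q ^ p)"
    unfolding z_def by (simp add: prod_qpoch_roots_unity [OF q p] euler_prod_def)
  finally have full: "(\<Prod>j = 1..<p. qpoch (z j * q) q) = euler_prod (q ^ p) / E"
    using E by (simp add: field_simps)
  have "(\<Prod>j = 1..m. klein 0 (of_nat j / of_nat p) \<tau>) =
      (\<Prod>j = 1..m. (- expi (- (of_nat j / of_nat p) / 2) * (1 - z j))
        * (qpoch (z j * q) q * qpoch (z (p - j) * q) q) / E ^ 2)"
    by (intro prod.cong refl klein)
  also have "\<dots> = (\<Prod>j = 1..m. - expi (- (of_nat j / of_nat p) / 2) * (1 - z j))
      * (euler_prod (q ^ p) / E) / (E ^ 2) ^ m"
    by (subst prod_dividef, subst prod.distrib, subst pairs, subst full) simp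
  finally have kl: "(\<Prod>j = 1..m. klein 0 (of_nat j / of_nat p) \<tau>) =
      (\<Prod>j = 1..m. - expi (- (of_nat j / of_nat p) / 2) * (1 - z j))
      * (euler_prod (q ^ p) / E) / (E ^ 2) ^ m" .
  have "dedekind_eta (of_nat p * \<tau>) = expi (of_nat p * (\<tau> / 24)) * euler_prod (q ^ p)"
    unfolding dedekind_eta_eq q_def expi_of_nat_mult [symmetric] by simp
  then have "eta_ratio p \<tau> = E ^ p / euler_prod (q ^ p)"
    unfolding eta_ratio_def dedekind_eta_eq [of \<tau>] expi_of_nat_mult
    by (simp add: power_mult_distrib E_def q_def)
  also have "E ^ p = E * (E ^ 2) ^ m"
    by (simp add: assms(1) power_mult)
  finally show ?thesis
    unfolding kl using E Ep by (simp add: z_def)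
qed

text \<open>Since \<open>p\<close> divides c and d - 1, the matrix moves the point (0, j/p) by an
  integral vector, so each Klein form returns up to a factor \<open>expi (e j)\<close>. The work
  lies in showing that these factors multiply to 1.\<close>

lemma eta_ratio_modular:
  fixes a b c d :: int
  assumes p: "p = 2 * m + 1" "24 dvd p ^ 2 - 1" and \<tau>: "Im \<tau> > 0"
    and det: "a * d - b * c = 1" and "int p dvd c" "int p dvd d - 1"
  shows "eta_ratio p ((of_int a * \<tau> + of_int b) / (of_int c * \<tau> + of_int d)) =
         (of_int c * \<tau> + of_int d) ^ m * eta_ratio p \<tau>"
proof -
  define J where "J = of_int c * \<tau> + of_int d"
  define \<sigma> where "\<sigma> = (of_int a * \<tau> + of_int b) / (of_int c * \<tau> + of_int d)"
  have J: "J \<noteq> 0"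
    unfolding J_def by (rule moebius_denominator_nonzero [OF det \<tau>])
  have \<sigma>: "Im \<sigma> > 0"
    using Im_moebius [OF det, of \<tau>] \<tau> J unfolding \<sigma>_def J_def [symmetric] by simp
  obtain c' where c': "c = int p * c'" using assms by (auto elim: dvdE)
  obtain d' where "d - 1 = int p * d'" using assms by (auto elim: dvdE)
  then have d': "d = 1 + int p * d'" by simp
  \<comment> \<open>As p^2 - 1 = 4 m (m + 1), the hypothesis says that m (m + 1) = 6 t. The sums of
    j and of j^2 for j up to m then become 3 t and t p.\<close>
  obtain t where "p ^ 2 - 1 = 24 * t" using p(2) by (auto elim: dvdE)
  then have mt: "m * (m + 1) = 6 * t"
    unfolding p(1) by (simp add: power2_eq_square algebra_simps)
  have p0: "of_nat p \<noteq> (0 :: complex)" using p by (simp only: of_nat_eq_0_iff)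
  define e where "e j = (of_int (int j * c') + of_int (int j * d') + of_int (int j * c') * of_int (int j * d')) / 2
      + (0 * of_int (int j * d') - of_int (int j * c') * (of_nat j / of_nat p)) / (2 :: complex)" for j
  have klein: "klein 0 (of_nat j / of_nat p) \<sigma> = expi (e j) * klein 0 (of_nat j / of_nat p) \<tau> / J" for j
  proof -
    have x: "0 * of_int a + of_nat j / of_nat p * of_int c = (0 + of_int (int j * c') :: complex)"
      using p0 by (simp add: c')
    have y: "0 * of_int b + of_nat j / of_nat p * of_int d =
        (of_nat j / of_nat p + of_int (int j * d') :: complex)"
      using p0 by (simp add: d' field_simps)
    show ?thesis
      unfolding \<sigma>_def J_def klein_modular [OF det \<tau>] x y klein_shift [OF \<tau>] e_def ..
  qed
  have "(\<Sum>j = 1..m. e j) \<in> \<int>"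
  proof -
    let ?S1 = "\<Sum>j = 1..m. of_nat j :: complex" and ?S2 = "\<Sum>j = 1..m. of_nat j ^ 2 :: complex"
    have mtc: "of_nat m * (of_nat m + 1) = (6 * of_nat t :: complex)"
      using arg_cong [OF mt, of "of_nat :: nat \<Rightarrow> complex"] by (simp add: algebra_simps)
    have S1: "?S1 = 3 * of_nat t"
      using sum_of_nat_formula [of m, where 'a = complex] mtc by simp
    have S2: "?S2 = of_nat t * of_nat p"
      using sum_of_nat_squares_formula [of m, where 'a = complex] mtc p(1) by simp
    have "e j = (of_int c' + of_int d') / 2 * of_nat j
        + (of_int c' * of_int d' / 2 - of_int c' / (2 * of_nat p)) * of_nat j ^ 2" for j
      by (simp add: e_def power2_eq_square add_divide_distrib diff_divide_distrib ring_distribs mult_ac)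
    then have "(\<Sum>j = 1..m. e j) = (of_int c' + of_int d') / 2 * ?S1
        + (of_int c' * of_int d' / 2 - of_int c' / (2 * of_nat p)) * ?S2"
      by (simp add: sum.distrib sum_distrib_left)
    also have "\<dots> = of_int (int t * (2 * c' + d' * (3 + int p * c'))) / 2"
      unfolding S1 S2 using p0 by (simp add: field_simps)
    finally have sum_e: "(\<Sum>j = 1..m. e j) = of_int (int t * (2 * c' + d' * (3 + int p * c'))) / 2" .
    \<comment> \<open>If d' is odd, then d is even, so c and c' are odd by the determinant and 3 + p
      c' is even.\<close>
    have "odd (int p)" using p by simp
    moreover have "odd (a * d - b * c)" using det by simp
    ultimately have "even (d' * (3 + int p * c'))"
      unfolding c' d' by auto
    then have "even (int t * (2 * c' + d' * (3 + int p * c')))"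
      by simp
    then obtain u where u: "int t * (2 * c' + d' * (3 + int p * c')) = 2 * u"
      by (elim evenE)
    show ?thesis
      unfolding sum_e u by simp
  qed
  moreover have "expi (\<Sum>j\<in>A. e j) = (\<Prod>j\<in>A. expi (e j))" for A
    by (induction A rule: infinite_finite_induct) (auto simp: expi_add)
  ultimately have prod_e: "(\<Prod>j = 1..m. expi (e j)) = 1"
    using expi_eq_1_iff by metis
  define K where "K \<tau> = (\<Prod>j = 1..m. klein 0 (of_nat j / of_nat p) \<tau>)" for \<tau>
  define C where "C = (\<Prod>j = 1..m. - expi (- (of_nat j / of_nat p) / 2) * (1 - expi (of_nat j / of_nat p)))"
  have K: "K \<sigma> = K \<tau> / J ^ m"
    unfolding K_def klein by (simp add: prod_dividef prod.distrib prod_e del: One_nat_def)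
  have KC: "K \<tau> * eta_ratio p \<tau> = C" if "Im \<tau> > 0" for \<tau>
    unfolding K_def C_def by (rule prod_klein_torsion [OF p(1) that])
  have "K \<tau> * eta_ratio p \<sigma> = K \<tau> * (J ^ m * eta_ratio p \<tau>)"
    using KC [OF \<tau>] KC [OF \<sigma>] J by (simp add: K field_simps)
  moreover have "K \<tau> \<noteq> 0"
  proof -
    \<comment> \<open>No j/p is an integer, so none of the factors of the constant \<open>C\<close>
      vanishes and the Klein product can be cancelled.\<close>
    have "of_nat j / of_nat p \<notin> (\<int> :: complex set)" if "j \<in> {1..m}" for j
    proof
      assume "of_nat j / of_nat p \<in> (\<int> :: complex set)"
      then obtain k :: int where "of_nat j / of_nat p = (of_int k :: complex)"
        by (auto elim: Ints_cases)
      then have "of_int (int j) = (of_int (k * int p) :: complex)"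
        using p0 by (simp add: field_simps)
      then have "int j = k * int p" by (simp only: of_int_eq_iff)
      then have "p dvd j" by (metis dvd_triv_right int_dvd_int_iff)
      then show False using that p(1) by (auto dest: dvd_imp_le)
    qed
    then have "C \<noteq> 0"
      unfolding C_def by (auto simp: expi_eq_1_iff dest: sym)
    then show ?thesis using KC [OF \<tau>] by auto
  qed
  ultimately show ?thesis
    by (simp add: \<sigma>_def J_def)
qed

subsection \<open>Eta quotients at the cusps\<close>

lemma holomorphic_on_dedekind_eta:
  assumes "open S" "f holomorphic_on S" "\<And>z. z \<in> S \<Longrightarrow> Im (f z) > 0"
  shows "(\<lambda>z. dedekind_eta (f z)) holomorphic_on S"
  unfolding dedekind_eta_eq
  using assms by (intro holomorphic_intros holomorphic_on_euler_prod) (auto simp: norm_expi_less_1)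

text \<open>The variable \<open>expi (\<tau> / (24 * of_nat N))\<close> serves all divisors
  \<open>D\<close> of \<open>N\<close> at once: in it every leading exponent is the integer
  \<open>e\<close>.\<close>

lemma dedekind_eta_expansion:
  assumes "A > 0" "D > 0" "D dvd N" "N > 0"
  defines "e \<equiv> A * (N div D)"
  shows "dedekind_eta ((of_nat A * \<tau> + of_int B) / of_nat D) =
         expi (of_int B / (24 * of_nat D)) * expi (\<tau> / (24 * of_nat N)) ^ e *
         euler_prod (expi (of_int B / of_nat D) * expi (\<tau> / (24 * of_nat N)) ^ (24 * e))"
proof -
  have "(of_nat N :: complex) = of_nat D * of_nat (N div D)"
    using assms by (simp flip: of_nat_mult)
  moreover have "N div D > 0"
    using assms by (simp add: div_greater_zero_iff dvd_imp_le)
  ultimately have e: "of_nat e / of_nat N = (of_nat A / of_nat D :: complex)"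
    using assms by (simp add: field_simps)
  have 1: "expi (\<tau> / (24 * of_nat N)) ^ e = expi (of_nat A * \<tau> / (24 * of_nat D))"
  proof -
    have "of_nat e * (\<tau> / (24 * of_nat N)) = of_nat e / of_nat N * \<tau> / 24" by simp
    then show ?thesis unfolding expi_of_nat_mult [symmetric] e by (simp add: mult_ac)
  qed
  have 2: "expi (\<tau> / (24 * of_nat N)) ^ (24 * e) = expi (of_nat A * \<tau> / of_nat D)"
  proof -
    have "of_nat (24 * e) * (\<tau> / (24 * of_nat N)) = of_nat e / of_nat N * \<tau>" by simp
    then show ?thesis unfolding expi_of_nat_mult [symmetric] e by (simp add: mult_ac)
  qed
  show ?thesis
    unfolding 1 2 dedekind_eta_eq expi_add [symmetric]
    by (simp add: add_divide_distrib add.commute mult.commute)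
qed

text \<open>The matrix with rows (\<delta> a, \<delta> b) and (c, d) factors as an element of
  SL_2(Z) times the upper triangular matrix with rows (A, B) and (0, D). The first factor is handled
  by \<open>eta24_modular\<close>.\<close>

lemma eta24_degeneracy:
  fixes a b c d :: int
  assumes det: "a * d - b * c = 1" and "\<delta> > 0"
  defines "A \<equiv> gcd \<delta> (nat \<bar>c\<bar>)"
  defines "D \<equiv> \<delta> div A"
  shows "\<exists>B :: int. \<forall>\<tau>. Im \<tau> > 0 \<longrightarrow>
    dedekind_eta (of_nat \<delta> * ((of_int a * \<tau> + of_int b) / (of_int c * \<tau> + of_int d))) ^ 24 =
    ((of_int c * \<tau> + of_int d) / of_nat D) ^ 12 *
      dedekind_eta ((of_nat A * \<tau> + of_int B) / of_nat D) ^ 24"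
proof -
  have A: "A > 0" using \<open>\<delta> > 0\<close> by (simp add: A_def)
  have AD: "\<delta> = A * D"
    unfolding D_def A_def by (rule dvd_mult_div_cancel [symmetric]) (rule gcd_dvd1)
  then have D: "D > 0" using \<open>\<delta> > 0\<close> by simp
  have "int A dvd int (nat \<bar>c\<bar>)"
    unfolding int_dvd_int_iff A_def by (rule gcd_dvd2)
  then have "int A dvd c" by simp
  then obtain c' where c': "c = int A * c'" by (elim dvdE)
  have "coprime c' (int D)"
  proof -
    have "int A * gcd (int D) c' = gcd (int \<delta>) c"
      unfolding c' AD using gcd_mult_distrib_int [of "int A" "int D" c'] by (simp only: abs_of_nat of_nat_mult)
    also have "\<dots> = int A" unfolding A_def by simp
    finally show ?thesis using A by (simp add: coprime_iff_gcd_eq_1 gcd.commute)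
  qed
  then obtain x where x: "[c' * x = 1] (mod int D)"
    using cong_solve_coprime_int by blast
  \<comment> \<open>This choice makes c' B congruent to d modulo \<open>D\<close>, so that the lower
    right entry d' of the unimodular factor is integral.\<close>
  define B where "B = x * d"
  have "[c' * x * d = 1 * d] (mod int D)"
    using x by (intro cong_mult) auto
  then have "int D dvd d - c' * B"
    unfolding B_def by (simp add: cong_iff_dvd_diff dvd_diff_commute mult.assoc)
  then obtain d' where "d - c' * B = int D * d'"
    by (elim dvdE)
  then have d': "d = c' * B + int D * d'"
    by simp
  define a' where "a' = a * int D"
  define b' where "b' = int A * b - a * B"
  have det': "a' * d' - b' * c' = 1"
    using det unfolding a'_def b'_def c' d' by (simp add: algebra_simps)
  have D0: "(of_nat D :: complex) \<noteq> 0" and A0: "(of_nat A :: complex) \<noteq> 0" using D A by auto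
  show ?thesis
  proof (intro exI [of _ B] allI impI)
    fix \<tau> :: complex assume \<tau>: "Im \<tau> > 0"
    define w where "w = (of_nat A * \<tau> + of_int B) / of_nat D"
    have w: "Im w > 0"
      using \<tau> A D by (simp add: w_def)
    have Dw: "of_nat D * w = of_nat A * \<tau> + of_int B"
      using D0 by (simp add: w_def)
    have "of_nat D * (of_int c' * w + of_int d') = of_int c' * (of_nat D * w) + of_nat D * of_int d'"
      by (simp add: algebra_simps)
    also have "\<dots> = of_int c * \<tau> + of_int d"
      unfolding Dw c' d' by (simp add: algebra_simps)
    finally have den: "of_int c' * w + of_int d' = (of_int c * \<tau> + of_int d) / of_nat D"
      using D0 by (simp add: field_simps)
    have "of_nat D * (of_int a' * w + of_int b') = of_int a' * (of_nat D * w) + of_nat D * of_int b'"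
      by (simp add: algebra_simps)
    also have "\<dots> = of_nat D * (of_nat A * (of_int a * \<tau> + of_int b))"
      unfolding Dw a'_def b'_def by (simp add: algebra_simps)
    finally have num: "of_int a' * w + of_int b' = of_nat A * (of_int a * \<tau> + of_int b)"
      using D0 by simp
    have "of_nat \<delta> * ((of_int a * \<tau> + of_int b) / (of_int c * \<tau> + of_int d)) =
        (of_int a' * w + of_int b') / (of_int c' * w + of_int d')"
      unfolding num den AD by (simp add: mult_ac)
    then show "dedekind_eta (of_nat \<delta> * ((of_int a * \<tau> + of_int b) / (of_int c * \<tau> + of_int d))) ^ 24 =
      ((of_int c * \<tau> + of_int d) / of_nat D) ^ 12 *
        dedekind_eta ((of_nat A * \<tau> + of_int B) / of_nat D) ^ 24"
      using eta24_modular [OF det' w] unfolding w_def [symmetric] by (simp only: den)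
  qed
qed

section \<open>Orders of eta quotients at the cusps\<close>

lemma prod_power_int_sum:
  fixes x :: "'a :: field"
  assumes "x \<noteq> 0"
  shows "(\<Prod>i\<in>I. x powi f i) = x powi (\<Sum>i\<in>I. f i)"
  by (induction I rule: infinite_finite_induct) (auto simp: power_int_add assms)

lemma SL2Z_det: "\<gamma> \<in> SL2Z \<Longrightarrow> \<gamma> $ 1 $ 1 * \<gamma> $ 2 $ 2 - \<gamma> $ 1 $ 2 * \<gamma> $ 2 $ 1 = 1"
  by (simp add: SL2Z_def det_2)

text \<open>Equal to \<open>N gcd(\<delta>, c)\<^sup>2 / \<delta>\<close>, which is \<open>24 N\<close> times the order of \<open>\<eta>(\<delta>\<tau>)\<close> at the cusp \<open>1/c\<close>
  with respect to \<open>e\<^bsup>2\<pi>\<i>\<tau>\<^esup>\<close>.\<close>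

definition cusp_exponent :: "nat \<Rightarrow> nat \<Rightarrow> nat \<Rightarrow> nat" where
  "cusp_exponent N c \<delta> = gcd \<delta> c * (N div (\<delta> div gcd \<delta> c))"

text \<open>Passing to 24th powers avoids the multiplier system of eta; the root is recovered below from the
  connectedness of the upper half-plane.\<close>

lemma eta_quotient_power24_expansion:
  assumes \<gamma>: "\<gamma> \<in> SL2Z" and N: "N > 0"
  obtains \<kappa> U where "\<kappa> \<noteq> 0" "U holomorphic_on ball 0 1" "\<And>x. x \<in> ball 0 1 \<Longrightarrow> U x \<noteq> 0"
    "\<And>\<tau>. Im \<tau> > 0 \<Longrightarrow> eta_quotient N r (moebius_act \<gamma> \<tau>) ^ 24 =
       \<kappa> * (of_int (\<gamma> $ 2 $ 1) * \<tau> + of_int (\<gamma> $ 2 $ 2)) powi (12 * (\<Sum>\<delta> | \<delta> dvd N. r \<delta>)) *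
       (expi (\<tau> / (24 * of_nat N)) powi
          (\<Sum>\<delta> | \<delta> dvd N. int (cusp_exponent N (nat (abs (\<gamma> $ 2 $ 1))) \<delta>) * r \<delta>) *
        U (expi (\<tau> / (24 * of_nat N)))) ^ 24"
proof -
  define a b c d where "a = \<gamma> $ 1 $ 1" and "b = \<gamma> $ 1 $ 2" and "c = \<gamma> $ 2 $ 1" and "d = \<gamma> $ 2 $ 2"
  have det: "a * d - b * c = 1"
    using SL2Z_det [OF \<gamma>] by (simp add: a_def b_def c_def d_def)
  define A where "A \<delta> = gcd \<delta> (nat \<bar>c\<bar>)" for \<delta> :: nat
  define D where "D \<delta> = \<delta> div A \<delta>" for \<delta> :: nat
  define e where "e \<delta> = cusp_exponent N (nat \<bar>c\<bar>) \<delta>" for \<delta>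
  have e: "e \<delta> = A \<delta> * (N div D \<delta>)" for \<delta>
    by (simp add: e_def cusp_exponent_def A_def D_def)
  have AD: "A \<delta> > 0" "D \<delta> > 0" "D \<delta> dvd N" "e \<delta> > 0" if "\<delta> dvd N" for \<delta>
  proof -
    have "\<delta> > 0" using that N by (auto intro: Nat.gr0I)
    then show "A \<delta> > 0" by (simp add: A_def)
    have *: "D \<delta> * A \<delta> = \<delta>"
      unfolding D_def A_def by (rule dvd_div_mult_self) (rule gcd_dvd1)
    with \<open>\<delta> > 0\<close> show "D \<delta> > 0" by (auto intro: Nat.gr0I)
    show "D \<delta> dvd N" using that * by (metis dvd_mult_left)
    then show "e \<delta> > 0"
      unfolding e using \<open>A \<delta> > 0\<close> \<open>D \<delta> > 0\<close> N by (auto simp: div_greater_zero_iff dvd_imp_le)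
  qed
  have "\<forall>\<delta>. \<exists>B :: int. \<delta> dvd N \<longrightarrow> (\<forall>\<tau>. Im \<tau> > 0 \<longrightarrow>
    dedekind_eta (of_nat \<delta> * ((of_int a * \<tau> + of_int b) / (of_int c * \<tau> + of_int d))) ^ 24 =
    ((of_int c * \<tau> + of_int d) / of_nat (D \<delta>)) ^ 12 *
      dedekind_eta ((of_nat (A \<delta>) * \<tau> + of_int B) / of_nat (D \<delta>)) ^ 24)"
  proof
    fix \<delta>
    show "\<exists>B :: int. \<delta> dvd N \<longrightarrow> (\<forall>\<tau>. Im \<tau> > 0 \<longrightarrow>
      dedekind_eta (of_nat \<delta> * ((of_int a * \<tau> + of_int b) / (of_int c * \<tau> + of_int d))) ^ 24 =
      ((of_int c * \<tau> + of_int d) / of_nat (D \<delta>)) ^ 12 *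
        dedekind_eta ((of_nat (A \<delta>) * \<tau> + of_int B) / of_nat (D \<delta>)) ^ 24)"
    proof (cases "\<delta> dvd N")
      case True
      then have "\<delta> > 0" using N by (auto intro: Nat.gr0I)
      then show ?thesis
        unfolding D_def A_def using eta24_degeneracy [OF det, of \<delta>] by blast
    qed auto
  qed
  then obtain B :: "nat \<Rightarrow> int" where B: "\<And>\<delta> \<tau>. \<delta> dvd N \<Longrightarrow> Im \<tau> > 0 \<Longrightarrow>
    dedekind_eta (of_nat \<delta> * ((of_int a * \<tau> + of_int b) / (of_int c * \<tau> + of_int d))) ^ 24 =
    ((of_int c * \<tau> + of_int d) / of_nat (D \<delta>)) ^ 12 *
      dedekind_eta ((of_nat (A \<delta>) * \<tau> + of_int (B \<delta>)) / of_nat (D \<delta>)) ^ 24"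
    unfolding choice_iff by blast
  define \<kappa>\<delta> where "\<kappa>\<delta> \<delta> = expi (of_int (B \<delta>) / (24 * of_nat (D \<delta>))) ^ 24 / of_nat (D \<delta>) ^ 12" for \<delta>
  define \<kappa> where "\<kappa> = (\<Prod>\<delta> | \<delta> dvd N. \<kappa>\<delta> \<delta> powi r \<delta>)"
  define V where "V \<delta> x = euler_prod (expi (of_int (B \<delta>) / of_nat (D \<delta>)) * x ^ (24 * e \<delta>))" for \<delta> x
  define U where "U x = (\<Prod>\<delta> | \<delta> dvd N. V \<delta> x powi r \<delta>)" for x
  have less: "norm (expi (of_int (B \<delta>) / of_nat (D \<delta>)) * x ^ (24 * e \<delta>)) < 1"
    if "x \<in> ball 0 1" "\<delta> dvd N" for x \<delta>
  proof -
    have "norm x ^ (24 * e \<delta>) < 1"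
      using that AD(4) [OF that(2)] by (auto simp: power_less_one_iff)
    moreover have "Im (of_int (B \<delta>) / of_nat (D \<delta>)) = 0"
      by simp
    then have "norm (expi (of_int (B \<delta>) / of_nat (D \<delta>))) = 1"
      unfolding norm_expi by simp
    ultimately show ?thesis by (simp only: norm_mult norm_power)
  qed
  have fin: "finite {\<delta>. \<delta> dvd N}" using N by simp
  have V_nz: "V \<delta> x \<noteq> 0" if "x \<in> ball 0 1" "\<delta> dvd N" for x \<delta>
    unfolding V_def by (rule euler_prod_nonzero [OF less [OF that]])
  show ?thesis
  proof (rule that [of \<kappa> U])
    show "\<kappa> \<noteq> 0"
      using fin AD(2) by (auto simp: \<kappa>_def \<kappa>\<delta>_def)
    show "U holomorphic_on ball 0 1"
    proof -
      have "V \<delta> holomorphic_on ball 0 1" if "\<delta> dvd N" for \<delta>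
        unfolding V_def [abs_def]
        by (intro holomorphic_on_euler_prod holomorphic_intros less that) auto
      then show ?thesis
        unfolding U_def by (intro holomorphic_on_prod holomorphic_on_power_int) (auto simp: V_nz)
    qed
    show "U x \<noteq> 0" if "x \<in> ball 0 1" for x
      using fin V_nz [OF that] by (auto simp: U_def)
    fix \<tau> :: complex assume \<tau>: "Im \<tau> > 0"
    define J where "J = of_int c * \<tau> + of_int d"
    define Q where "Q = expi (\<tau> / (24 * of_nat N))"
    have J: "J \<noteq> 0"
      unfolding J_def by (rule moebius_denominator_nonzero [OF det \<tau>])
    have Q: "Q \<noteq> 0" by (simp add: Q_def)
    have factor: "(dedekind_eta (of_nat \<delta> * ((of_int a * \<tau> + of_int b) / J)) powi r \<delta>) ^ 24 =
       \<kappa>\<delta> \<delta> powi r \<delta> * (J powi (12 * r \<delta>)) * (Q powi (int (e \<delta>) * r \<delta>) * V \<delta> Q powi r \<delta>) ^ 24"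
      if "\<delta> dvd N" for \<delta>
    proof -
      have "(dedekind_eta (of_nat \<delta> * ((of_int a * \<tau> + of_int b) / J)) powi r \<delta>) ^ 24 =
          (dedekind_eta (of_nat \<delta> * ((of_int a * \<tau> + of_int b) / J)) ^ 24) powi r \<delta>"
        by (simp add: power_int_power power_int_power' mult.commute)
      also have "dedekind_eta (of_nat \<delta> * ((of_int a * \<tau> + of_int b) / J)) ^ 24 =
          (J / of_nat (D \<delta>)) ^ 12 * dedekind_eta ((of_nat (A \<delta>) * \<tau> + of_int (B \<delta>)) / of_nat (D \<delta>)) ^ 24"
        unfolding J_def by (rule B [OF that \<tau>])
      also have "dedekind_eta ((of_nat (A \<delta>) * \<tau> + of_int (B \<delta>)) / of_nat (D \<delta>)) =
          expi (of_int (B \<delta>) / (24 * of_nat (D \<delta>))) * Q ^ e \<delta> * V \<delta> Q"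
        unfolding V_def Q_def e by (rule dedekind_eta_expansion [OF AD(1-3) [OF that] N])
      also have "(J / of_nat (D \<delta>)) ^ 12 *
          (expi (of_int (B \<delta>) / (24 * of_nat (D \<delta>))) * Q ^ e \<delta> * V \<delta> Q) ^ 24 =
          \<kappa>\<delta> \<delta> * J ^ 12 * (Q ^ e \<delta> * V \<delta> Q) ^ 24"
        by (simp add: \<kappa>\<delta>_def power_divide power_mult_distrib)
      finally show ?thesis
        by (simp add: power_int_mult_distrib power_int_power power_int_power' mult_ac power_mult_distrib)
    qed
    have "eta_quotient N r (moebius_act \<gamma> \<tau>) ^ 24 =
        (\<Prod>\<delta> | \<delta> dvd N. (dedekind_eta (of_nat \<delta> * ((of_int a * \<tau> + of_int b) / J)) powi r \<delta>) ^ 24)"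
      unfolding eta_quotient_def moebius_act_def a_def b_def c_def d_def J_def
      by (simp add: prod_power_distrib)
    also have "\<dots> = (\<Prod>\<delta> | \<delta> dvd N. \<kappa>\<delta> \<delta> powi r \<delta> * (J powi (12 * r \<delta>)) *
        (Q powi (int (e \<delta>) * r \<delta>) * V \<delta> Q powi r \<delta>) ^ 24)"
      by (intro prod.cong refl factor) auto
    also have "\<dots> = \<kappa> * J powi (12 * (\<Sum>\<delta> | \<delta> dvd N. r \<delta>)) *
        (Q powi (\<Sum>\<delta> | \<delta> dvd N. int (e \<delta>) * r \<delta>) * U Q) ^ 24"
      by (simp add: prod.distrib prod_power_distrib [symmetric] prod_power_int_sum J Q \<kappa>_def U_def
          sum_distrib_left)
    finally show "eta_quotient N r (moebius_act \<gamma> \<tau>) ^ 24 =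
       \<kappa> * (of_int (\<gamma> $ 2 $ 1) * \<tau> + of_int (\<gamma> $ 2 $ 2)) powi (12 * (\<Sum>\<delta> | \<delta> dvd N. r \<delta>)) *
       (expi (\<tau> / (24 * of_nat N)) powi
          (\<Sum>\<delta> | \<delta> dvd N. int (cusp_exponent N (nat (abs (\<gamma> $ 2 $ 1))) \<delta>) * r \<delta>) *
        U (expi (\<tau> / (24 * of_nat N)))) ^ 24"
      by (simp only: J_def Q_def c_def d_def e_def)
  qed
qed

lemma holomorphic_on_eta_quotient:
  assumes "N > 0"
  shows "eta_quotient N r holomorphic_on upper_half_plane"
proof -
  have op: "open upper_half_plane"
    unfolding upper_half_plane_def by (rule open_halfspace_Im_gt)
  have pos: "Im (of_nat \<delta> * \<tau>) > 0" if "\<delta> dvd N" "\<tau> \<in> upper_half_plane" for \<delta> \<tau>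
    using that assms by (auto simp: upper_half_plane_def intro: Nat.gr0I)
  have "(\<lambda>\<tau>. dedekind_eta (of_nat \<delta> * \<tau>)) holomorphic_on upper_half_plane" if "\<delta> dvd N" for \<delta>
    by (intro holomorphic_on_dedekind_eta op holomorphic_intros pos that)
  then have "(\<lambda>\<tau>. eta_quotient N r \<tau>) holomorphic_on upper_half_plane"
    unfolding eta_quotient_def
    by (intro holomorphic_on_prod holomorphic_on_power_int)
       (auto intro!: dedekind_eta_nonzero pos)
  then show ?thesis by simp
qed

lemma eta_quotient_nonzero:
  assumes "N > 0" "Im \<tau> > 0"
  shows "eta_quotient N r \<tau> \<noteq> 0"
proof -
  have "dedekind_eta (of_nat \<delta> * \<tau>) \<noteq> 0" if "\<delta> dvd N" for \<delta>
    using that assms by (auto intro!: dedekind_eta_nonzero Nat.gr0I)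
  then show ?thesis
    using assms by (simp add: eta_quotient_def)
qed

text \<open>The weight condition is exactly what cancels the powers of the automorphy
  factor.\<close>

lemma slash_eta_quotient_power24:
  fixes \<gamma> :: "int ^ 2 ^ 2"
  assumes \<gamma>: "\<gamma> \<in> SL2Z" and N: "N > 0" and weight: "(\<Sum>\<delta> | \<delta> dvd N. r \<delta>) = 2 * k"
  obtains \<kappa> U where "\<kappa> \<noteq> 0" "U holomorphic_on ball 0 1" "\<And>x. x \<in> ball 0 1 \<Longrightarrow> U x \<noteq> 0"
    "\<And>\<tau>. Im \<tau> > 0 \<Longrightarrow> slash k (eta_quotient N r) \<gamma> \<tau> ^ 24 =
       \<kappa> * (expi (\<tau> / (24 * of_nat N)) powi
          (\<Sum>\<delta> | \<delta> dvd N. int (cusp_exponent N (nat (abs (\<gamma> $ 2 $ 1))) \<delta>) * r \<delta>) *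
        U (expi (\<tau> / (24 * of_nat N)))) ^ 24"
proof -
  obtain \<kappa> U where U: "\<kappa> \<noteq> 0" "U holomorphic_on ball 0 1" "\<And>x. x \<in> ball 0 1 \<Longrightarrow> U x \<noteq> 0"
    and eq: "\<And>\<tau>. Im \<tau> > 0 \<Longrightarrow> eta_quotient N r (moebius_act \<gamma> \<tau>) ^ 24 =
       \<kappa> * (of_int (\<gamma> $ 2 $ 1) * \<tau> + of_int (\<gamma> $ 2 $ 2)) powi (12 * (\<Sum>\<delta> | \<delta> dvd N. r \<delta>)) *
       (expi (\<tau> / (24 * of_nat N)) powi
          (\<Sum>\<delta> | \<delta> dvd N. int (cusp_exponent N (nat (abs (\<gamma> $ 2 $ 1))) \<delta>) * r \<delta>) *
        U (expi (\<tau> / (24 * of_nat N)))) ^ 24"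
    using eta_quotient_power24_expansion [OF \<gamma> N, of r] by blast
  show ?thesis
  proof (rule that [OF U])
    fix \<tau> :: complex assume \<tau>: "Im \<tau> > 0"
    define J where "J = of_int (\<gamma> $ 2 $ 1) * \<tau> + of_int (\<gamma> $ 2 $ 2)"
    have J: "J \<noteq> 0"
      unfolding J_def by (rule moebius_denominator_nonzero [OF SL2Z_det [OF \<gamma>] \<tau>])
    have "(J powi (- k)) ^ 24 * J powi (12 * (2 * k)) = 1"
      using J by (simp add: power_int_power' flip: power_int_add)
    then show "slash k (eta_quotient N r) \<gamma> \<tau> ^ 24 =
       \<kappa> * (expi (\<tau> / (24 * of_nat N)) powi
          (\<Sum>\<delta> | \<delta> dvd N. int (cusp_exponent N (nat (abs (\<gamma> $ 2 $ 1))) \<delta>) * r \<delta>) *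
        U (expi (\<tau> / (24 * of_nat N)))) ^ 24"
      unfolding slash_def power_mult_distrib eq [OF \<tau>] weight J_def [symmetric] by simp
  qed auto
qed

lemma Im_moebius_act_pos:
  assumes "\<gamma> \<in> SL2Z" "Im \<tau> > 0"
  shows "Im (moebius_act \<gamma> \<tau>) > 0"
  using Im_moebius [OF SL2Z_det [OF assms(1)]] moebius_denominator_nonzero [OF SL2Z_det [OF assms(1)] assms(2)]
    assms(2) by (simp add: moebius_act_def)

lemma continuous_on_slash:
  assumes \<gamma>: "\<gamma> \<in> SL2Z" and "f holomorphic_on upper_half_plane"
  shows "continuous_on upper_half_plane (slash k f \<gamma>)"
proof -
  have nz: "of_int (\<gamma> $ 2 $ 1) * \<tau> + of_int (\<gamma> $ 2 $ 2) \<noteq> (0 :: complex)"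
    if "\<tau> \<in> upper_half_plane" for \<tau>
    using moebius_denominator_nonzero [OF SL2Z_det [OF \<gamma>]] that by (simp add: upper_half_plane_def)
  have "continuous_on upper_half_plane (moebius_act \<gamma>)"
    unfolding moebius_act_def [abs_def] by (intro continuous_intros) (use nz in auto)
  moreover have "moebius_act \<gamma> ` upper_half_plane \<subseteq> upper_half_plane"
    using Im_moebius_act_pos [OF \<gamma>] by (auto simp: upper_half_plane_def)
  ultimately have "continuous_on upper_half_plane (\<lambda>\<tau>. f (moebius_act \<gamma> \<tau>))"
    using continuous_on_compose2 [OF holomorphic_on_imp_continuous_on [OF assms(2)]] by blast
  then show ?thesis
    unfolding slash_def [abs_def] by (intro continuous_intros) (use nz in auto)
qed

text \<open>The quotient of F by Q^M U(Q) is continuous and its 24th power is constant. It takes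
  finitely many values on a connected set, hence is constant, and F itself is holomorphic in Q when
  M is nonnegative.\<close>

lemma holomorphic_at_infinity_slash_eta_quotient:
  fixes \<gamma> :: "int ^ 2 ^ 2"
  assumes \<gamma>: "\<gamma> \<in> SL2Z" and N: "N > 0" and weight: "(\<Sum>\<delta> | \<delta> dvd N. r \<delta>) = 2 * k"
    and order: "0 \<le> (\<Sum>\<delta> | \<delta> dvd N. int (cusp_exponent N (nat (abs (\<gamma> $ 2 $ 1))) \<delta>) * r \<delta>)"
  shows "holomorphic_at_infinity (slash k (eta_quotient N r) \<gamma>)"
proof -
  define M where "M = (\<Sum>\<delta> | \<delta> dvd N. int (cusp_exponent N (nat (abs (\<gamma> $ 2 $ 1))) \<delta>) * r \<delta>)"
  define F where "F = slash k (eta_quotient N r) \<gamma>"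
  define Q where "Q \<tau> = expi (\<tau> / (24 * of_nat N))" for \<tau>
  obtain \<kappa> U where U: "\<kappa> \<noteq> 0" "U holomorphic_on ball 0 1" "\<And>x. x \<in> ball 0 1 \<Longrightarrow> U x \<noteq> 0"
    and eq: "\<And>\<tau>. Im \<tau> > 0 \<Longrightarrow> F \<tau> ^ 24 = \<kappa> * (Q \<tau> powi M * U (Q \<tau>)) ^ 24"
    using slash_eta_quotient_power24 [OF \<gamma> N weight] unfolding M_def F_def Q_def by blast
  have QB: "Q \<tau> \<in> ball 0 1" if "Im \<tau> > 0" for \<tau>
    using that N by (simp add: Q_def norm_expi)
  have Q0: "Q \<tau> \<noteq> 0" for \<tau> by (simp add: Q_def)
  have UQ: "U (Q \<tau>) \<noteq> 0" if "Im \<tau> > 0" for \<tau>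
    by (rule U(3) [OF QB [OF that]])
  define \<rho> where "\<rho> \<tau> = F \<tau> / (Q \<tau> powi M * U (Q \<tau>))" for \<tau>
  have "continuous_on upper_half_plane Q"
    unfolding Q_def by (intro continuous_intros) (use N in auto)
  moreover have "continuous_on (Q ` upper_half_plane) U"
    by (rule continuous_on_subset [OF holomorphic_on_imp_continuous_on [OF U(2)]])
       (use QB in \<open>auto simp: upper_half_plane_def\<close>)
  ultimately have "continuous_on upper_half_plane (\<lambda>\<tau>. U (Q \<tau>))"
    using continuous_on_compose2 by blast
  then have "continuous_on upper_half_plane \<rho>"
    unfolding \<rho>_def F_def
    using \<open>continuous_on upper_half_plane Q\<close> continuous_on_slash [OF \<gamma> holomorphic_on_eta_quotient [OF N]]
    by (intro continuous_intros) (auto simp: Q0 UQ upper_half_plane_def)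
  moreover have "\<rho> ` upper_half_plane \<subseteq> {z. z ^ 24 = \<kappa>}"
    by (auto simp: \<rho>_def power_divide eq Q0 UQ upper_half_plane_def)
  then have "finite (\<rho> ` upper_half_plane)"
    by (rule finite_subset) (rule finite_nth_roots, simp)
  moreover have "connected upper_half_plane"
    unfolding upper_half_plane_def by (intro convex_connected convex_halfspace_Im_gt)
  ultimately have "\<rho> constant_on upper_half_plane"
    using continuous_finite_range_constant by blast
  then obtain \<rho>0 where \<rho>0: "\<And>\<tau>. \<tau> \<in> upper_half_plane \<Longrightarrow> \<rho> \<tau> = \<rho>0"
    unfolding constant_on_def by blast
  have "F \<tau> = \<rho>0 * Q \<tau> ^ nat M * U (Q \<tau>)" if "\<tau> \<in> upper_half_plane" for \<tau>
  proof -
    have "Q \<tau> powi M * U (Q \<tau>) \<noteq> 0"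
      using that by (auto simp: Q0 UQ upper_half_plane_def)
    then have "F \<tau> = \<rho> \<tau> * (Q \<tau> powi M * U (Q \<tau>))"
      by (simp add: \<rho>_def)
    then show ?thesis
      using order by (simp add: \<rho>0 [OF that] power_int_nonneg_exp M_def)
  qed
  moreover have "(\<lambda>x. \<rho>0 * x ^ nat M * U x) holomorphic_on ball 0 1"
    by (intro holomorphic_intros U)
  moreover have "Q \<tau> = exp (2 * of_real pi * \<i> * \<tau> / of_nat (24 * N))" for \<tau>
    by (simp add: Q_def expi_def)
  ultimately show ?thesis
    unfolding holomorphic_at_infinity_def F_def [symmetric] using N
    by (intro exI [of _ "24 * N"] exI [of _ "\<lambda>x. \<rho>0 * x ^ nat M * U x"] conjI) auto
qed

text \<open>Suppose the order \<open>M\<close> is negative. Going up the imaginary axis, g(X)^24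
  Q^(-24 M) tends to 0, yet it equals \<open>\<kappa>\<close> U(Q)^24, whose limit is
  nonzero.\<close>

lemma order_nonneg_of_holomorphic_at_infinity:
  fixes \<gamma> :: "int ^ 2 ^ 2"
  assumes \<gamma>: "\<gamma> \<in> SL2Z" and N: "N > 0" and weight: "(\<Sum>\<delta> | \<delta> dvd N. r \<delta>) = 2 * k"
    and hol: "holomorphic_at_infinity (slash k (eta_quotient N r) \<gamma>)"
  shows "(\<Sum>\<delta> | \<delta> dvd N. int (cusp_exponent N (nat (abs (\<gamma> $ 2 $ 1))) \<delta>) * r \<delta>) \<ge> 0"
proof (rule ccontr)
  define M where "M = (\<Sum>\<delta> | \<delta> dvd N. int (cusp_exponent N (nat (abs (\<gamma> $ 2 $ 1))) \<delta>) * r \<delta>)"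
  assume "\<not> ?thesis"
  then have M: "M < 0" by (simp add: M_def)
  obtain \<kappa> U where U: "\<kappa> \<noteq> 0" "U holomorphic_on ball 0 1" "\<And>x. x \<in> ball 0 1 \<Longrightarrow> U x \<noteq> 0"
    and eq: "\<And>\<tau>. Im \<tau> > 0 \<Longrightarrow> slash k (eta_quotient N r) \<gamma> \<tau> ^ 24 =
       \<kappa> * (expi (\<tau> / (24 * of_nat N)) powi M * U (expi (\<tau> / (24 * of_nat N)))) ^ 24"
    using slash_eta_quotient_power24 [OF \<gamma> N weight] unfolding M_def by blast
  obtain h g where h: "h > 0" "g holomorphic_on ball 0 1"
    "\<And>\<tau>. Im \<tau> > 0 \<Longrightarrow> slash k (eta_quotient N r) \<gamma> \<tau> = g (expi (\<tau> / of_nat h))"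
    using hol unfolding holomorphic_at_infinity_def expi_def upper_half_plane_def by auto
  have lim: "(\<lambda>n. expi (of_nat (Suc n) * \<i> / of_nat m)) \<longlonglongrightarrow> 0" if "m > 0" for m :: nat
  proof -
    have "expi (of_nat (Suc n) * \<i> / of_nat m) = expi (\<i> / of_nat m) ^ Suc n" for n
      unfolding expi_of_nat_mult [symmetric] by (rule arg_cong [where f = expi]) simp
    moreover have "norm (expi (\<i> / of_nat m)) < 1"
      using that by (intro norm_expi_less_1) simp
    ultimately show ?thesis
      using LIMSEQ_Suc [OF LIMSEQ_power_zero [of "expi (\<i> / of_nat m)"]] by (simp only:)
  qed
  \<comment> \<open>\<open>X\<close> is the local parameter of the unknown width \<open>h\<close>,
    \<open>Q\<close> that of width \<open>24 * N\<close>. Both tend to 0, so the widths need not be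
    compared.\<close>
  define X where "X n = expi (of_nat (Suc n) * \<i> / of_nat h)" for n
  define Q where "Q n = expi (of_nat (Suc n) * \<i> / of_nat (24 * N))" for n
  have X: "X \<longlonglongrightarrow> 0" and Q: "Q \<longlonglongrightarrow> 0"
    unfolding X_def [abs_def] Q_def [abs_def] by (rule lim; use h N in simp)+
  have "isCont g 0" "isCont U 0"
    using h(2) U(2) by (auto intro!: continuous_on_interior [of "ball 0 1"] holomorphic_on_imp_continuous_on)
  then have gX: "(\<lambda>n. g (X n)) \<longlonglongrightarrow> g 0" and UQ: "(\<lambda>n. U (Q n)) \<longlonglongrightarrow> U 0"
    using isCont_tendsto_compose [OF \<open>isCont g 0\<close> X] isCont_tendsto_compose [OF \<open>isCont U 0\<close> Q] by simp_all
  have "(\<lambda>n. g (X n) ^ 24 * (Q n ^ nat (- M)) ^ 24) \<longlonglongrightarrow> g 0 ^ 24 * (0 ^ nat (- M)) ^ 24"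
    by (intro tendsto_mult tendsto_power gX Q)
  moreover have "(\<lambda>n. \<kappa> * U (Q n) ^ 24) \<longlonglongrightarrow> \<kappa> * U 0 ^ 24"
    by (intro tendsto_mult tendsto_const tendsto_power UQ)
  moreover have "g (X n) ^ 24 * (Q n ^ nat (- M)) ^ 24 = \<kappa> * U (Q n) ^ 24" for n
  proof -
    define \<tau> where "\<tau> = of_nat (Suc n) * \<i>"
    have \<tau>: "Im \<tau> > 0" by (simp add: \<tau>_def)
    have "g (X n) ^ 24 = \<kappa> * (Q n powi M * U (Q n)) ^ 24"
      using eq [OF \<tau>] h(3) [OF \<tau>] by (simp add: X_def Q_def \<tau>_def)
    then have "g (X n) ^ 24 * (Q n ^ nat (- M)) ^ 24 =
        \<kappa> * (Q n powi M * Q n ^ nat (- M)) ^ 24 * U (Q n) ^ 24"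
      by (simp only: power_mult_distrib mult_ac)
    moreover have "Q n powi M * Q n ^ nat (- M) = 1"
    proof -
      have "Q n ^ nat (- M) = Q n powi (- M)" using M by (simp add: power_int_nonneg_exp)
      then show ?thesis by (simp add: power_int_minus Q_def)
    qed
    ultimately show ?thesis
      by simp
  qed
  ultimately have "g 0 ^ 24 * (0 ^ nat (- M)) ^ 24 = \<kappa> * U 0 ^ 24"
    using LIMSEQ_unique by simp
  moreover have "(0 :: complex) ^ nat (- M) = 0"
    using M by (intro zero_power) simp
  ultimately show False
    using U(1) U(3) [of 0] by simp
qed

section \<open>Necessary conditions: weight, congruence modulo 24, cusp orders\<close>

text \<open>For the matrix with rows (1, 0) and (N, 1), every eta(\<delta> tau)^24 picks up the same
  factor J^12. At tau = i the norm of \<open>J\<close> exceeds 1, so a power of \<open>J\<close>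
  equal to 1 must have exponent 0.\<close>

lemma eta_quotient_modular_weight:
  assumes N: "N > 0" and f: "eta_quotient N r \<in> modular_forms k (Gamma1 N)"
  shows "(\<Sum>\<delta> | \<delta> dvd N. r \<delta>) = 2 * k"
proof -
  define \<gamma> :: "int ^ 2 ^ 2" where "\<gamma> = vector [vector [1, 0], vector [int N, 1]]"
  have g: "\<gamma> $ 1 $ 1 = 1" "\<gamma> $ 1 $ 2 = 0" "\<gamma> $ 2 $ 1 = int N" "\<gamma> $ 2 $ 2 = 1"
    by (simp_all add: \<gamma>_def)
  then have "\<gamma> \<in> Gamma1 N"
    by (simp add: Gamma1_def SL2Z_def det_2 cong_0_iff)
  define \<tau> where "\<tau> = \<i>"
  define J where "J = of_nat N * \<tau> + 1"
  have \<tau>: "Im \<tau> > 0" by (simp add: \<tau>_def)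
  have "norm J ^ 2 = 1 + real N ^ 2" by (simp add: J_def \<tau>_def cmod_power2)
  then have "1 ^ 2 < norm J ^ 2" using N by simp
  then have J1: "norm J > 1" by (rule power2_less_imp_less) simp
  have "slash k (eta_quotient N r) \<gamma> \<tau> = eta_quotient N r \<tau>"
    using f \<open>\<gamma> \<in> Gamma1 N\<close> \<tau> unfolding modular_forms_def upper_half_plane_def by blast
  then have 1: "(J powi (- k)) ^ 24 * eta_quotient N r (\<tau> / J) ^ 24 = eta_quotient N r \<tau> ^ 24"
    unfolding slash_def moebius_act_def g power_mult_distrib [symmetric] by (simp add: J_def)
  have eta: "dedekind_eta (of_nat \<delta> * (\<tau> / J)) ^ 24 = J ^ 12 * dedekind_eta (of_nat \<delta> * \<tau>) ^ 24"
    if \<delta>: "\<delta> dvd N" for \<delta>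
  proof -
    obtain e where e: "N = \<delta> * e" using \<delta> by (elim dvdE)
    then have "\<delta> > 0" using N by simp
    then show ?thesis
      using eta24_modular [of 1 1 0 "int e" "of_nat \<delta> * \<tau>"] \<tau> by (simp add: J_def e mult_ac)
  qed
  have "eta_quotient N r (\<tau> / J) ^ 24 = (\<Prod>\<delta> | \<delta> dvd N. (dedekind_eta (of_nat \<delta> * (\<tau> / J)) ^ 24) powi r \<delta>)"
    unfolding eta_quotient_def prod_power_distrib
    by (simp add: power_int_power power_int_power' mult.commute)
  also have "\<dots> = (\<Prod>\<delta> | \<delta> dvd N. J powi (12 * r \<delta>) * (dedekind_eta (of_nat \<delta> * \<tau>) powi r \<delta>) ^ 24)"
  proof (intro prod.cong refl)
    fix \<delta> assume "\<delta> \<in> {\<delta>. \<delta> dvd N}"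
    then have "(dedekind_eta (of_nat \<delta> * (\<tau> / J)) ^ 24) powi r \<delta> =
        (J ^ 12 * dedekind_eta (of_nat \<delta> * \<tau>) ^ 24) powi r \<delta>"
      by (simp only: eta mem_Collect_eq)
    then show "(dedekind_eta (of_nat \<delta> * (\<tau> / J)) ^ 24) powi r \<delta> =
        J powi (12 * r \<delta>) * (dedekind_eta (of_nat \<delta> * \<tau>) powi r \<delta>) ^ 24"
      by (simp add: power_int_mult_distrib power_int_power power_int_power' mult.commute)
  qed
  also have "\<dots> = J powi (12 * (\<Sum>\<delta> | \<delta> dvd N. r \<delta>)) * eta_quotient N r \<tau> ^ 24"
  proof -
    have "J \<noteq> 0" using J1 by auto
    then show ?thesis
      by (simp add: prod.distrib prod_power_int_sum eta_quotient_def prod_power_distrib sum_distrib_left)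
  qed
  finally have "(J powi (- k)) ^ 24 * J powi (12 * (\<Sum>\<delta> | \<delta> dvd N. r \<delta>)) * eta_quotient N r \<tau> ^ 24
      = eta_quotient N r \<tau> ^ 24"
    using 1 by (simp add: mult.assoc)
  then have "(J powi (- k)) ^ 24 * J powi (12 * (\<Sum>\<delta> | \<delta> dvd N. r \<delta>)) = 1"
    using eta_quotient_nonzero [OF N \<tau>, of r] by simp
  moreover have "J powi (- k * int 24 + 12 * (\<Sum>\<delta> | \<delta> dvd N. r \<delta>)) =
      (J powi (- k)) ^ 24 * J powi (12 * (\<Sum>\<delta> | \<delta> dvd N. r \<delta>))"
    by (subst power_int_add) (use J1 in \<open>auto simp: power_int_power'\<close>)
  ultimately have "J powi (12 * (\<Sum>\<delta> | \<delta> dvd N. r \<delta>) - 24 * k) = 1"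
    by (simp add: algebra_simps)
  then have "norm J powi (12 * (\<Sum>\<delta> | \<delta> dvd N. r \<delta>) - 24 * k) = 1"
    by (metis norm_one norm_power_int)
  then have "12 * (\<Sum>\<delta> | \<delta> dvd N. r \<delta>) - 24 * k = 0"
    using J1 power_int_strict_increasing [of "12 * (\<Sum>\<delta> | \<delta> dvd N. r \<delta>) - 24 * k" 0 "norm J"]
      power_int_strict_increasing [of 0 "12 * (\<Sum>\<delta> | \<delta> dvd N. r \<delta>) - 24 * k" "norm J"]
    by (cases "12 * (\<Sum>\<delta> | \<delta> dvd N. r \<delta>) - 24 * k" "0 :: int" rule: linorder_cases) auto
  then show ?thesis by simp
qed

text \<open>Translation by 1 multiplies the quotient by a 24th root of unity with the stated sum as
  exponent. The quotient does not vanish, so this root is 1.\<close>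

lemma eta_quotient_modular_cong:
  assumes N: "N > 0" and f: "eta_quotient N r \<in> modular_forms k (Gamma1 N)"
  shows "24 dvd (\<Sum>\<delta> | \<delta> dvd N. int \<delta> * r \<delta>)"
proof -
  define \<gamma> :: "int ^ 2 ^ 2" where "\<gamma> = vector [vector [1, 1], vector [0, 1]]"
  have g: "\<gamma> $ 1 $ 1 = 1" "\<gamma> $ 1 $ 2 = 1" "\<gamma> $ 2 $ 1 = 0" "\<gamma> $ 2 $ 2 = 1"
    by (simp_all add: \<gamma>_def)
  then have "\<gamma> \<in> Gamma1 N"
    by (simp add: Gamma1_def SL2Z_def det_2)
  then have "slash k (eta_quotient N r) \<gamma> \<i> = eta_quotient N r \<i>"
    using f unfolding modular_forms_def upper_half_plane_def by simp
  then have 1: "eta_quotient N r (\<i> + 1) = eta_quotient N r \<i>"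
    unfolding slash_def moebius_act_def g by simp
  have "dedekind_eta (of_nat \<delta> * (\<i> + 1)) = expi (1 / 24) ^ \<delta> * dedekind_eta (of_nat \<delta> * \<i>)" for \<delta>
  proof -
    have "expi (of_nat \<delta> * (\<i> + 1)) = expi (of_nat \<delta> * \<i>)"
      by (rule expi_cong_Ints) (simp add: ring_distribs)
    moreover have "expi (of_nat \<delta> * (\<i> + 1) / 24) = expi (of_nat \<delta> * (1 / 24)) * expi (of_nat \<delta> * \<i> / 24)"
      unfolding expi_add [symmetric] by (rule arg_cong [where f = expi]) (simp add: field_simps)
    ultimately show ?thesis
      unfolding dedekind_eta_eq expi_of_nat_mult [of \<delta> "1 / 24", symmetric] by simp
  qed
  then have "eta_quotient N r (\<i> + 1) =
      (\<Prod>\<delta> | \<delta> dvd N. expi (1 / 24) powi (int \<delta> * r \<delta>)) * eta_quotient N r \<i>"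
    by (simp add: eta_quotient_def power_int_mult_distrib prod.distrib power_int_power)
  also have "(\<Prod>\<delta> | \<delta> dvd N. expi (1 / 24) powi (int \<delta> * r \<delta>)) =
      expi (1 / 24) powi (\<Sum>\<delta> | \<delta> dvd N. int \<delta> * r \<delta>)"
    by (rule prod_power_int_sum) simp
  finally have *: "expi (1 / 24) powi (\<Sum>\<delta> | \<delta> dvd N. int \<delta> * r \<delta>) = 1"
    using 1 eta_quotient_nonzero [OF N, of \<i> r] by simp
  have "expi z powi n = expi (of_int n * z)" for z n
    unfolding expi_def exp_power_int by (simp add: mult_ac)
  then have "of_int (\<Sum>\<delta> | \<delta> dvd N. int \<delta> * r \<delta>) * (1 / 24) \<in> (\<int> :: complex set)"
    using * by (simp only: expi_eq_1_iff)
  then obtain m :: int where "of_int (\<Sum>\<delta> | \<delta> dvd N. int \<delta> * r \<delta>) * (1 / 24) = (of_int m :: complex)"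
    by (elim Ints_cases)
  then have "(of_int (\<Sum>\<delta> | \<delta> dvd N. int \<delta> * r \<delta>) :: complex) = of_int (24 * m)"
    by (simp add: field_simps)
  then show ?thesis
    by (simp only: of_int_eq_iff dvd_triv_left)
qed

text \<open>The matrix with rows (1, 0) and (c, 1) represents the cusp 1/c; the order depends on the
  lower left entry only.\<close>

lemma eta_quotient_modular_order:
  assumes N: "N > 0" and f: "eta_quotient N r \<in> modular_forms k (Gamma1 N)"
  shows "(\<Sum>\<delta> | \<delta> dvd N. int (cusp_exponent N c \<delta>) * r \<delta>) \<ge> 0"
proof -
  define \<gamma> :: "int ^ 2 ^ 2" where "\<gamma> = vector [vector [1, 0], vector [int c, 1]]"
  have g: "\<gamma> $ 1 $ 1 = 1" "\<gamma> $ 1 $ 2 = 0" "\<gamma> $ 2 $ 1 = int c" "\<gamma> $ 2 $ 2 = 1"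
    by (simp_all add: \<gamma>_def)
  then have \<gamma>: "\<gamma> \<in> SL2Z"
    by (simp add: SL2Z_def det_2)
  then have "holomorphic_at_infinity (slash k (eta_quotient N r) \<gamma>)"
    using f by (simp add: modular_forms_def)
  from order_nonneg_of_holomorphic_at_infinity [OF \<gamma> N eta_quotient_modular_weight [OF N f] this]
  show ?thesis by (simp add: g)
qed

subsection \<open>Level \<open>p q\<close>\<close>

lemma divisors_semiprime:
  fixes p q :: nat
  assumes "prime p" "prime q"
  shows "{\<delta>. \<delta> dvd p * q} = {1, p, q, p * q}"
proof (intro equalityI subsetI)
  fix \<delta> assume "\<delta> \<in> {\<delta>. \<delta> dvd p * q}"
  then obtain x y where "\<delta> = x * y" "x dvd p" "y dvd q"
    by (auto elim: dvd_productE)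
  moreover have "x = 1 \<or> x = p" "y = 1 \<or> y = q"
    using calculation assms by (auto simp: prime_nat_iff)
  ultimately show "\<delta> \<in> {1, p, q, p * q}" by auto
qed auto

lemma sum_divisors_semiprime:
  fixes p q :: nat and g :: "nat \<Rightarrow> 'a :: comm_monoid_add"
  assumes "prime p" "prime q" "p \<noteq> q"
  shows "(\<Sum>\<delta> | \<delta> dvd p * q. g \<delta>) = g 1 + g p + g q + g (p * q)"
proof -
  have "p > 1" "q > 1" using assms prime_gt_1_nat by auto
  then show ?thesis
    unfolding divisors_semiprime [OF assms(1,2)] using assms(3) by (simp add: add_ac)
qed

lemma prod_divisors_semiprime:
  fixes p q :: nat and g :: "nat \<Rightarrow> 'a :: comm_monoid_mult"
  assumes "prime p" "prime q" "p \<noteq> q"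
  shows "(\<Prod>\<delta> | \<delta> dvd p * q. g \<delta>) = g 1 * g p * g q * g (p * q)"
proof -
  have "p > 1" "q > 1" using assms prime_gt_1_nat by auto
  then show ?thesis
    unfolding divisors_semiprime [OF assms(1,2)] using assms(3) by (simp add: mult_ac)
qed

lemma prime_ge_5_mod_24:
  fixes p :: nat
  assumes "prime p" "p \<ge> 5"
  shows "p mod 24 \<in> {1, 5, 7, 11, 13, 17, 19, 23}"
proof -
  have "\<not> 2 dvd p" "\<not> 3 dvd p"
    using assms by (auto simp: prime_nat_iff)
  then show ?thesis by simp presburger
qed

lemma prime_ge_5_square:
  fixes p :: nat
  assumes "prime p" "p \<ge> 5"
  shows "24 dvd p ^ 2 - 1"
proof -
  have "(p mod 24) ^ 2 mod 24 = 1"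
    using prime_ge_5_mod_24 [OF assms] by auto
  then have "p ^ 2 mod 24 = 1"
    by (simp add: power_mod)
  then show ?thesis
    by (metis dvd_minus_mod)
qed

section \<open>Invariance of eta quotients of level p q\<close>

lemma eta_ratio_slash_prime:
  fixes a b c d :: int
  assumes "prime p" "p \<ge> 5" and \<tau>: "Im \<tau> > 0"
    and det: "a * d - b * c = 1" and "int p dvd c" "int p dvd d - 1"
  shows "eta_ratio p ((of_int a * \<tau> + of_int b) / (of_int c * \<tau> + of_int d)) =
         (of_int c * \<tau> + of_int d) ^ ((p - 1) div 2) * eta_ratio p \<tau>"
proof -
  have "odd p"
    using assms(1,2) prime_odd_nat by auto
  then have "p = 2 * ((p - 1) div 2) + 1" by simp
  then show ?thesis
    using eta_ratio_modular [OF _ prime_ge_5_square [OF assms(1,2)] \<tau> det assms(5,6)] by blast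
qed

text \<open>Eliminating eta at p tau, q tau and p q tau leaves eta(tau) with exponent 24 m. Every
  factor is then modular on \<Gamma>_1(p q) without multiplier.\<close>

lemma eta_quotient_semiprime_factorization:
  fixes p q :: nat
  assumes pq: "prime p" "prime q" "p \<noteq> q" and \<tau>: "Im \<tau> > 0"
    and m: "r 1 + int p * r p + int q * r q + int (p * q) * r (p * q) = 24 * m"
  shows "eta_quotient (p * q) r \<tau> =
    (dedekind_eta \<tau> ^ 24) powi m * eta_ratio p \<tau> powi (- r p) *
    eta_ratio q \<tau> powi (- r q - int p * r (p * q)) * eta_ratio p (of_nat q * \<tau>) powi (- r (p * q))"
proof -
  have pos: "p > 0" "q > 0" using pq prime_gt_0_nat by auto
  define x y z w where "x = dedekind_eta \<tau>" and "y = eta_ratio p \<tau>" and "z = eta_ratio q \<tau>"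
    and "w = eta_ratio p (of_nat q * \<tau>)"
  have nz: "x \<noteq> 0" "y \<noteq> 0" "z \<noteq> 0" "w \<noteq> 0"
    using \<tau> pos by (simp_all add: x_def y_def z_def w_def dedekind_eta_nonzero eta_ratio_nonzero)
  have inv: "dedekind_eta (of_nat n * \<sigma>) = dedekind_eta \<sigma> ^ n / eta_ratio n \<sigma>" if "Im \<sigma> > 0" "n > 0" for n \<sigma>
    using that by (auto simp: eta_ratio_def dedekind_eta_nonzero)
  have 1: "dedekind_eta (of_nat p * \<tau>) = x ^ p / y" "dedekind_eta (of_nat q * \<tau>) = x ^ q / z"
    unfolding x_def y_def z_def by (intro inv \<tau> pos)+
  have "dedekind_eta (of_nat (p * q) * \<tau>) = dedekind_eta (of_nat q * \<tau>) ^ p / w"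
    using inv [of "of_nat q * \<tau>" p] \<tau> pos by (simp add: w_def mult.assoc)
  then have 2: "dedekind_eta (of_nat (p * q) * \<tau>) = (x ^ q / z) ^ p / w"
    unfolding 1 .
  have "eta_quotient (p * q) r \<tau> =
      x powi r 1 * (x ^ p / y) powi r p * (x ^ q / z) powi r q * ((x ^ q / z) ^ p / w) powi r (p * q)"
    unfolding eta_quotient_def prod_divisors_semiprime [OF pq] 1 2 by (simp add: x_def)
  also have "\<dots> = x powi (r 1 + int p * r p + int q * r q + int (p * q) * r (p * q)) * y powi (- r p) *
      z powi (- r q - int p * r (p * q)) * w powi (- r (p * q))"
    using nz
    by (simp add: power_int_add power_int_diff power_int_minus power_int_divide_distrib power_int_power
        power_int_mult_distrib power_divide power_mult [symmetric] field_simps)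
  also have "x powi (r 1 + int p * r p + int q * r q + int (p * q) * r (p * q)) = (x ^ 24) powi m"
    unfolding m by (simp add: power_int_power)
  finally show ?thesis by (simp only: x_def y_def z_def w_def)
qed

lemma eta_quotient_semiprime_slash:
  fixes p q :: nat
  assumes pq: "prime p" "prime q" "p \<noteq> q" "p \<ge> 5" "q \<ge> 5" and \<tau>: "Im \<tau> > 0"
    and weight: "r 1 + r p + r q + r (p * q) = 2 * k"
    and dvd: "24 dvd r 1 + int p * r p + int q * r q + int (p * q) * r (p * q)"
    and \<gamma>: "\<gamma> \<in> Gamma1 (p * q)"
  shows "slash k (eta_quotient (p * q) r) \<gamma> \<tau> = eta_quotient (p * q) r \<tau>"
proof -
  obtain m where m: "r 1 + int p * r p + int q * r q + int (p * q) * r (p * q) = 24 * m"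
    using dvd by (elim dvdE)
  define a b c d where "a = \<gamma> $ 1 $ 1" and "b = \<gamma> $ 1 $ 2" and "c = \<gamma> $ 2 $ 1" and "d = \<gamma> $ 2 $ 2"
  have SL: "\<gamma> \<in> SL2Z" using \<gamma> by (simp add: Gamma1_def)
  have det: "a * d - b * c = 1"
    using SL2Z_det [OF SL] by (simp add: a_def b_def c_def d_def)
  have cd: "int (p * q) dvd c" "int (p * q) dvd d - 1"
    using \<gamma> by (auto simp: Gamma1_def c_def d_def cong_0_iff cong_iff_dvd_diff)
  have pcd: "int p dvd c" "int p dvd d - 1" "int q dvd c" "int q dvd d - 1"
    using cd by (auto dest: dvd_mult_left dvd_mult_right)
  obtain c' where "c = int (p * q) * c'" using cd by (elim dvdE)
  then have c': "c = int q * (int p * c')" by simp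
  define J where "J = of_int c * \<tau> + of_int d"
  define \<sigma> where "\<sigma> = (of_int a * \<tau> + of_int b) / (of_int c * \<tau> + of_int d)"
  have J: "J \<noteq> 0"
    unfolding J_def by (rule moebius_denominator_nonzero [OF det \<tau>])
  have \<sigma>: "Im \<sigma> > 0"
    using Im_moebius_act_pos [OF SL \<tau>] by (simp add: moebius_act_def \<sigma>_def a_def b_def c_def d_def)
  define P Q where "P = (p - 1) div 2" and "Q = (q - 1) div 2"
  have PQ: "int p = 2 * int P + 1" "int q = 2 * int Q + 1"
    using pq(1,2,4,5) prime_odd_nat [of p] prime_odd_nat [of q] unfolding P_def Q_def
    by (auto elim!: oddE)
  have eta: "dedekind_eta \<sigma> ^ 24 = J ^ 12 * dedekind_eta \<tau> ^ 24"
    unfolding \<sigma>_def J_def by (rule eta24_modular [OF det \<tau>])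
  have Ep: "eta_ratio p \<sigma> = J ^ P * eta_ratio p \<tau>" and Eq: "eta_ratio q \<sigma> = J ^ Q * eta_ratio q \<tau>"
    unfolding \<sigma>_def J_def P_def Q_def by (intro eta_ratio_slash_prime pq \<tau> det pcd)+
  \<comment> \<open>Conjugation by diag(q, 1) replaces c by c/q and b by q b; since p q divides c,
    the new lower left entry is still divisible by p.\<close>
  have Epq: "eta_ratio p (of_nat q * \<sigma>) = J ^ P * eta_ratio p (of_nat q * \<tau>)"
  proof -
    have det': "a * d - (int q * b) * (int p * c') = 1"
      using det unfolding c' by (simp add: algebra_simps)
    have \<tau>': "Im (of_nat q * \<tau>) > 0" using \<tau> pq by simp
    have J': "of_int (int p * c') * (of_nat q * \<tau>) + of_int d = J"
      by (simp add: J_def c' mult_ac)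
    have "of_nat q * \<sigma> = (of_int a * (of_nat q * \<tau>) + of_int (int q * b)) / J"
      unfolding \<sigma>_def J_def by (simp add: ring_distribs mult_ac)
    then show ?thesis
      using eta_ratio_slash_prime [OF pq(1,4) \<tau>' det' _ pcd(2)] unfolding J' P_def by simp
  qed
  \<comment> \<open>The weights of the four factors add up to \<open>k\<close>.\<close>
  have expo: "12 * m + int P * - r p + int Q * (- r q - int p * r (p * q)) + int P * - r (p * q) = k"
  proof -
    have "2 * (12 * m + int P * - r p + int Q * (- r q - int p * r (p * q)) + int P * - r (p * q))
        = 24 * m - (int p - 1) * r p - (int q - 1) * (r q + int p * r (p * q)) - (int p - 1) * r (p * q)"
      unfolding PQ by (simp add: algebra_simps)
    also have "\<dots> = r 1 + r p + r q + r (p * q)"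
      unfolding m [symmetric] by (simp add: algebra_simps)
    finally show ?thesis using weight by simp
  qed
  have "eta_quotient (p * q) r \<sigma> =
      J powi (12 * m + int P * - r p + int Q * (- r q - int p * r (p * q)) + int P * - r (p * q))
        * eta_quotient (p * q) r \<tau>"
    unfolding eta_quotient_semiprime_factorization [OF pq(1-3) \<sigma> m]
      eta_quotient_semiprime_factorization [OF pq(1-3) \<tau> m] eta Ep Eq Epq power_int_mult_distrib
      power_int_power power_int_add [OF disjI1 [OF J]]
    by (simp only: mult_ac of_nat_numeral)
  then have "eta_quotient (p * q) r \<sigma> = J powi k * eta_quotient (p * q) r \<tau>"
    unfolding expo .
  then show ?thesis
    using J by (simp add: slash_def moebius_act_def power_int_minus
        a_def [symmetric] b_def [symmetric] c_def [symmetric] d_def [symmetric] \<sigma>_def J_def)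
qed

lemma eta_quotient_semiprime_modular_form:
  fixes p q :: nat
  assumes pq: "prime p" "prime q" "p \<noteq> q" "p \<ge> 5" "q \<ge> 5"
    and weight: "r 1 + r p + r q + r (p * q) = 2 * k"
    and dvd: "24 dvd r 1 + int p * r p + int q * r q + int (p * q) * r (p * q)"
    and order: "\<And>c. 0 \<le> (\<Sum>\<delta> | \<delta> dvd p * q. int (cusp_exponent (p * q) c \<delta>) * r \<delta>)"
  shows "eta_quotient (p * q) r \<in> modular_forms k (Gamma1 (p * q))"
proof -
  have N: "p * q > 0" using pq by simp
  have w: "(\<Sum>\<delta> | \<delta> dvd p * q. r \<delta>) = 2 * k"
    using weight sum_divisors_semiprime [OF pq(1-3), of r] by simp
  show ?thesis
    unfolding modular_forms_def
    using holomorphic_on_eta_quotient [OF N] eta_quotient_semiprime_slash [OF pq _ weight dvd]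
      holomorphic_at_infinity_slash_eta_quotient [OF _ N w order]
    by (auto simp: upper_half_plane_def)
qed

section \<open>Signs of the exponents in weight 2\<close>

text \<open>The nonnegative forms have the fixed sum 4 (P + 1) (Q + 1). Inverting the system bounds
  (P - 1) (Q - 1) a below by -4 M, where M is the larger of P and Q. As (P - 1) (Q - 1) is at least
  6 (M - 1) > 4 M, a is greater than -1. For P = 5 the factor 6 would drop to 4 and the comparison
  would fail.\<close>

lemma order_inequalities_imp_nonneg:
  fixes P Q a b c d :: int
  assumes PQ: "P \<ge> 7" "Q \<ge> 7" and sum: "a + b + c + d = 4"
    and ge: "0 \<le> P * Q * a + Q * b + P * c + d" "0 \<le> Q * a + P * Q * b + c + P * d"
      "0 \<le> P * a + b + P * Q * c + Q * d" "0 \<le> a + P * b + Q * c + P * Q * d"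
  shows "a \<ge> 0"
proof -
  define x y z w where "x = P * Q * a + Q * b + P * c + d" and "y = Q * a + P * Q * b + c + P * d"
    and "z = P * a + b + P * Q * c + Q * d" and "w = a + P * b + Q * c + P * Q * d"
  define M where "M = max P Q"
  have M: "P \<le> M" "Q \<le> M" by (auto simp: M_def)
  have nn: "0 \<le> x" "0 \<le> y" "0 \<le> z" "0 \<le> w"
    using ge by (auto simp: x_def y_def z_def w_def)
  have total: "x + y + z + w = (P + 1) * (Q + 1) * 4"
    unfolding x_def y_def z_def w_def sum [symmetric] by (simp add: algebra_simps)
  \<comment> \<open>The matrix of the four forms is a tensor product of two \<open>2 \<times> 2\<close> matrices, hence easy to invert.\<close>
  have inv: "(P + 1) * (Q + 1) * ((P - 1) * (Q - 1) * a) = P * Q * x - Q * y - P * z + w"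
    unfolding x_def y_def z_def w_def by (simp add: algebra_simps)
  have "(P + 1) * (Q + 1) * (- (4 * M)) = - (M * (x + y + z + w))"
    unfolding total by (simp add: algebra_simps)
  also have "\<dots> \<le> 0 - M * y - M * z + 0"
  proof -
    have "0 \<le> M * x" "0 \<le> M * w" using nn M PQ by auto
    then show ?thesis by (simp add: ring_distribs)
  qed
  also have "\<dots> \<le> P * Q * x - Q * y - P * z + w"
    using nn M PQ by (intro add_mono diff_mono mult_right_mono mult_nonneg_nonneg) auto
  finally have bound: "- (4 * M) \<le> (P - 1) * (Q - 1) * a"
    unfolding inv [symmetric] by (rule mult_left_le_imp_le) (use PQ in simp)
  have "6 * (M - 1) \<le> (P - 1) * (Q - 1)"
  proof (cases "P \<le> Q")
    case True
    then have "6 * (Q - 1) \<le> (P - 1) * (Q - 1)" using PQ by (intro mult_right_mono) auto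
    then show ?thesis using True by (simp add: M_def)
  next
    case False
    then have "(P - 1) * 6 \<le> (P - 1) * (Q - 1)" using PQ by (intro mult_left_mono) auto
    then show ?thesis using False by (simp add: M_def)
  qed
  moreover have "4 * M < 6 * (M - 1)" using M PQ by simp
  ultimately have less: "4 * M < (P - 1) * (Q - 1)" by (rule less_le_trans [rotated])
  show ?thesis
  proof (rule ccontr)
    assume "\<not> a \<ge> 0"
    then have "(P - 1) * (Q - 1) * a \<le> (P - 1) * (Q - 1) * (- 1)"
      using PQ by (intro mult_left_mono) auto
    then show False using bound less by linarith
  qed
qed

section \<open>Modular forms from given exponents\<close>

definition semiprime_exponents :: "nat \<Rightarrow> nat \<Rightarrow> int \<Rightarrow> int \<Rightarrow> int \<Rightarrow> int \<Rightarrow> nat \<Rightarrow> int" where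
  "semiprime_exponents p q a b c d \<delta> =
     (if \<delta> = 1 then a else if \<delta> = p then b else if \<delta> = q then c else d)"

lemma semiprime_exponents_simps:
  assumes "prime p" "prime q" "p \<noteq> q"
  shows "semiprime_exponents p q a b c d 1 = a" "semiprime_exponents p q a b c d p = b"
    "semiprime_exponents p q a b c d q = c" "semiprime_exponents p q a b c d (p * q) = d"
proof -
  have "p > 1" "q > 1" using assms prime_gt_1_nat by auto
  then show "semiprime_exponents p q a b c d 1 = a" "semiprime_exponents p q a b c d p = b"
    "semiprime_exponents p q a b c d q = c" "semiprime_exponents p q a b c d (p * q) = d"
    using assms by (auto simp: semiprime_exponents_def)
qed

text \<open>The cusp exponents are natural numbers, so the order conditions hold automatically and
  only weight and congruence remain.\<close>

lemma modular_form_of_nonneg_exponents: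
  assumes pq: "prime p" "prime q" "p \<noteq> q" "p \<ge> 5" "q \<ge> 5"
    and "a \<ge> 0" "b \<ge> 0" "c \<ge> 0" "d \<ge> 0" and "a + b + c + d = 2 * k"
    and "24 dvd a + int p * b + int q * c + int (p * q) * d"
  shows "\<exists>r. eta_quotient (p * q) r \<in> modular_forms k (Gamma1 (p * q))"
proof (intro exI eta_quotient_semiprime_modular_form [OF pq])
  fix C
  show "0 \<le> (\<Sum>\<delta> | \<delta> dvd p * q.
      int (cusp_exponent (p * q) C \<delta>) * semiprime_exponents p q a b c d \<delta>)"
    using assms by (intro sum_nonneg mult_nonneg_nonneg) (auto simp: semiprime_exponents_def)
qed (simp_all only: semiprime_exponents_simps [OF pq(1-3)] assms)

text \<open>The form is eta(tau)^5 / eta(5 tau): its weight is 2, the sum in the congruence is 5 - 5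
  = 0, and at each cusp the exponent of eta(5 tau) is at most 5 times that of eta(tau).\<close>

lemma modular_form_level_5:
  assumes pq: "prime p" "prime q" "p \<noteq> q" "p \<ge> 5" "q \<ge> 5" and "p = 5 \<or> q = 5"
  shows "\<exists>r. eta_quotient (p * q) r \<in> modular_forms 2 (Gamma1 (p * q))"
proof -
  have ex1: "cusp_exponent N c 1 = N" for N c
    by (simp add: cusp_exponent_def)
  have "prime (5 :: nat)" using assms by auto
  then have ex5: "cusp_exponent N c 5 \<le> 5 * N" if "5 dvd N" for N c
  proof -
    have "gcd 5 c = 1 \<or> gcd 5 c = 5"
      using \<open>prime 5\<close> gcd_dvd1 [of 5 c] unfolding prime_nat_iff by blast
    then show ?thesis by (auto simp: cusp_exponent_def)
  qed
  show ?thesis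
  proof (cases "p = 5")
    case True
    have "eta_quotient (p * q) (semiprime_exponents p q 5 (- 1) 0 0) \<in> modular_forms 2 (Gamma1 (p * q))"
    proof (rule eta_quotient_semiprime_modular_form [OF pq])
      fix c
      show "0 \<le> (\<Sum>\<delta> | \<delta> dvd p * q.
          int (cusp_exponent (p * q) c \<delta>) * semiprime_exponents p q 5 (- 1) 0 0 \<delta>)"
        unfolding sum_divisors_semiprime [OF pq(1-3)] semiprime_exponents_simps [OF pq(1-3)] ex1
        using ex5 [of "p * q" c] True by simp
    qed (unfold semiprime_exponents_simps [OF pq(1-3)], use True in simp_all)
    then show ?thesis by blast
  next
    case False
    then have q5: "q = 5" using assms by simp
    have "eta_quotient (p * q) (semiprime_exponents p q 5 0 (- 1) 0) \<in> modular_forms 2 (Gamma1 (p * q))"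
    proof (rule eta_quotient_semiprime_modular_form [OF pq])
      fix c
      show "0 \<le> (\<Sum>\<delta> | \<delta> dvd p * q.
          int (cusp_exponent (p * q) c \<delta>) * semiprime_exponents p q 5 0 (- 1) 0 \<delta>)"
        unfolding sum_divisors_semiprime [OF pq(1-3)] semiprime_exponents_simps [OF pq(1-3)] ex1
        using ex5 [of "p * q" c] q5 by simp
    qed (unfold semiprime_exponents_simps [OF pq(1-3)], use q5 in simp_all)
    then show ?thesis by blast
  qed
qed

section \<open>The four cusp inequalities at level p q\<close>

lemma cusp_exponent_semiprime:
  assumes pq: "prime p" "prime q" "p \<noteq> q"
  shows "cusp_exponent (p * q) 1 1 = p * q" "cusp_exponent (p * q) 1 p = q"
    "cusp_exponent (p * q) 1 q = p" "cusp_exponent (p * q) 1 (p * q) = 1"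
    "cusp_exponent (p * q) p 1 = p * q" "cusp_exponent (p * q) p p = p * (p * q)"
    "cusp_exponent (p * q) p q = p" "cusp_exponent (p * q) p (p * q) = p * p"
    "cusp_exponent (p * q) q 1 = p * q" "cusp_exponent (p * q) q p = q"
    "cusp_exponent (p * q) q q = q * (p * q)" "cusp_exponent (p * q) q (p * q) = q * q"
proof -
  have pos: "p > 0" "q > 0" using pq prime_gt_0_nat by auto
  have cop: "gcd p q = 1" "gcd q p = 1"
    using primes_coprime [OF pq] by (auto simp: gcd.commute)
  show "cusp_exponent (p * q) 1 1 = p * q" "cusp_exponent (p * q) 1 p = q"
    "cusp_exponent (p * q) 1 q = p" "cusp_exponent (p * q) 1 (p * q) = 1"
    "cusp_exponent (p * q) p 1 = p * q" "cusp_exponent (p * q) p p = p * (p * q)"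
    "cusp_exponent (p * q) p q = p" "cusp_exponent (p * q) p (p * q) = p * p"
    "cusp_exponent (p * q) q 1 = p * q" "cusp_exponent (p * q) q p = q"
    "cusp_exponent (p * q) q q = q * (p * q)" "cusp_exponent (p * q) q (p * q) = q * q"
    using pos by (simp_all add: cusp_exponent_def cop)
qed

text \<open>The cusps 1/c for c = 1, p, q, p q give, after removal of the common factors 1, p, q and
  p q, the inequalities of \<open>order_inequalities_imp_nonneg\<close>.\<close>

lemma weight_2_exponents_nonneg:
  assumes pq: "prime p" "prime q" "p \<noteq> q" "p \<ge> 7" "q \<ge> 7"
    and f: "eta_quotient (p * q) r \<in> modular_forms 2 (Gamma1 (p * q))"
  shows "r 1 \<ge> 0" "r p \<ge> 0" "r q \<ge> 0" "r (p * q) \<ge> 0"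
proof -
  have N: "p * q > 0" using pq by simp
  have pos: "int p > 0" "int q > 0" "int p * int q > 0" using pq by auto
  have cancel: "0 \<le> y" if "0 \<le> x * y" "0 < x" for x y :: int
    using that by (simp add: zero_le_mult_iff)
  have sum: "r 1 + r p + r q + r (p * q) = 4"
    using eta_quotient_modular_weight [OF N f] unfolding sum_divisors_semiprime [OF pq(1-3)] by simp
  note order = eta_quotient_modular_order [OF N f, unfolded sum_divisors_semiprime [OF pq(1-3)]]
  have 1: "0 \<le> int p * int q * r 1 + int q * r p + int p * r q + r (p * q)"
    using order [of 1] unfolding cusp_exponent_semiprime [OF pq(1-3)] by simp
  have "0 \<le> int p * (int q * r 1 + int p * int q * r p + r q + int p * r (p * q))"
    using order [of p] unfolding cusp_exponent_semiprime [OF pq(1-3)] by (simp add: algebra_simps)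
  then have 2: "0 \<le> int q * r 1 + int p * int q * r p + r q + int p * r (p * q)"
    by (rule cancel [OF _ pos(1)])
  have "0 \<le> int q * (int p * r 1 + r p + int p * int q * r q + int q * r (p * q))"
    using order [of q] unfolding cusp_exponent_semiprime [OF pq(1-3)] by (simp add: algebra_simps)
  then have 3: "0 \<le> int p * r 1 + r p + int p * int q * r q + int q * r (p * q)"
    by (rule cancel [OF _ pos(2)])
  have "gcd (\<delta> :: nat) (p * q) = \<delta>" if "\<delta> dvd p * q" for \<delta>
    using that by (simp add: gcd_proj1_iff)
  then have "cusp_exponent (p * q) (p * q) \<delta> = \<delta> * (p * q)" if "\<delta> dvd p * q" "\<delta> > 0" for \<delta>
    using that by (simp add: cusp_exponent_def)
  then have "0 \<le> int p * int q * (r 1 + int p * r p + int q * r q + int p * int q * r (p * q))"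
    using order [of "p * q"] pq by (simp add: algebra_simps)
  then have 4: "0 \<le> r 1 + int p * r p + int q * r q + int p * int q * r (p * q)"
    by (rule cancel [OF _ pos(3)])
  have PQ: "int p \<ge> 7" "int q \<ge> 7" using pq by auto
  show "r 1 \<ge> 0"
    by (rule order_inequalities_imp_nonneg [OF PQ sum]) (use 1 2 3 4 in \<open>simp_all add: add_ac\<close>)
  \<comment> \<open>Exchanging the exponents at 1 and p, and those at q and p q, only permutes the
    four inequalities. The remaining two exponents follow by the analogous exchange for q and by
    both together.\<close>
  show "r p \<ge> 0"
    by (rule order_inequalities_imp_nonneg [OF PQ, of _ "r 1" "r (p * q)" "r q"])
       (use sum 1 2 3 4 in \<open>simp_all add: add_ac\<close>)
  show "r q \<ge> 0"
    by (rule order_inequalities_imp_nonneg [OF PQ, of _ "r (p * q)" "r 1" "r p"])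
       (use sum 1 2 3 4 in \<open>simp_all add: add_ac\<close>)
  show "r (p * q) \<ge> 0"
    by (rule order_inequalities_imp_nonneg [OF PQ, of _ "r q" "r p" "r 1"])
       (use sum 1 2 3 4 in \<open>simp_all add: add_ac\<close>)
qed

section \<open>Existence, decided by residues modulo 24\<close>

lemma dvd_24_residues:
  fixes p q :: nat and a b c d :: int
  shows "24 dvd a + int p * b + int q * c + int (p * q) * d \<longleftrightarrow>
    24 dvd a + int (p mod 24) * b + int (q mod 24) * c + int (p mod 24 * (q mod 24)) * d"
proof -
  have "[int p = int (p mod 24)] (mod 24)" "[int q = int (q mod 24)] (mod 24)"
    by (simp_all add: cong_def zmod_int)
  then have "[a + int p * b + int q * c + int p * int q * d =
      a + int (p mod 24) * b + int (q mod 24) * c + int (p mod 24) * int (q mod 24) * d] (mod 24)"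
    by (intro cong_add cong_mult) auto
  then show ?thesis
    using cong_dvd_iff by fastforce
qed

lemma gcd_24_pred_residues:
  fixes p q :: nat
  assumes "p mod 24 > 0" "q mod 24 > 0"
  shows "gcd 24 (gcd (p - 1) (q - 1)) = gcd 24 (gcd (p mod 24 - 1) (q mod 24 - 1))"
proof -
  have 1: "gcd 24 (n - 1) = gcd 24 (n mod 24 - 1)" if "n mod 24 > 0" for n :: nat
  proof -
    have "n - 1 = (n mod 24 - 1) + n div 24 * 24"
      using that by (metis Nat.add_diff_assoc2 One_nat_def Suc_leI add.commute div_mult_mod_eq)
    then show ?thesis by (metis gcd.commute gcd_add_mult gcd_red_nat mod_mult_self1)
  qed
  have 2: "gcd 24 (gcd x y) = gcd (gcd 24 x) (gcd 24 y)" for x y :: nat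
    by (metis gcd.assoc gcd.left_commute gcd.left_idem)
  show ?thesis unfolding 2 1 [OF assms(1)] 1 [OF assms(2)] ..
qed

text \<open>Exponents of \<open>\<eta>(\<tau>), \<eta>(p\<tau>), \<eta>(q\<tau>), \<eta>(p q\<tau>)\<close> found by a search over all residues of \<open>p\<close>
  and \<open>q\<close> modulo 24; their sum is twice the weight.\<close>

definition exponent_table :: "(nat \<times> nat \<times> nat \<times> nat) list" where
  "exponent_table = [(1, 1, 1, 1), (9, 1, 1, 1), (2, 2, 2, 2), (1, 0, 1, 2), (2, 0, 1, 1), (1, 0, 2, 1),
     (11, 0, 0, 1), (11, 0, 1, 0), (24, 0, 0, 0)]"

text \<open>An admissible 2 k is divisible by 4 and by the gcd, hence by their lcm. A row whose sum
  divides this lcm can therefore be scaled to every admissible weight. All 64 residue pairs are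
  checked by evaluation.\<close>

lemma exponent_table_residues:
  "\<forall>P\<in>set [1, 5, 7, 11, 13, 17, 19, 23 :: nat]. \<forall>Q\<in>set [1, 5, 7, 11, 13, 17, 19, 23 :: nat].
     (P, Q) \<in> set [(1, 5), (5, 1), (5, 5)] \<or>
     (\<exists>(a, b, c, d)\<in>set exponent_table. 24 dvd a + P * b + Q * c + P * Q * d \<and>
        a + b + c + d dvd lcm 4 (gcd 24 (gcd (P - 1) (Q - 1))))"
  by code_simp

text \<open>The row for the residues of \<open>p\<close> and \<open>q\<close> is multiplied by t,
  where 2 k is t times the row sum; scaling keeps the congruence and the signs.\<close>

lemma modular_form_exists_generic:
  fixes p q :: nat and k :: int
  assumes pq: "prime p" "prime q" "p \<noteq> q" "p \<ge> 5" "q \<ge> 5"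
    and k: "even k" "k \<ge> 0" "int (gcd 24 (gcd (p - 1) (q - 1))) dvd 2 * k"
    and generic: "(p mod 24, q mod 24) \<notin> {(1, 5), (5, 1), (5, 5)}"
  shows "\<exists>r. eta_quotient (p * q) r \<in> modular_forms k (Gamma1 (p * q))"
proof -
  define P Q where "P = p mod 24" and "Q = q mod 24"
  have res: "P \<in> set [1, 5, 7, 11, 13, 17, 19, 23]" "Q \<in> set [1, 5, 7, 11, 13, 17, 19, 23]"
    unfolding P_def Q_def using prime_ge_5_mod_24 [OF pq(1,4)] prime_ge_5_mod_24 [OF pq(2,5)] by auto
  then have "P > 0" "Q > 0" by auto
  have "(P, Q) \<notin> set [(1, 5), (5, 1), (5, 5)]"
    using generic by (simp add: P_def Q_def)
  then have "\<exists>(a, b, c, d)\<in>set exponent_table. 24 dvd a + P * b + Q * c + P * Q * d \<and>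
        a + b + c + d dvd lcm 4 (gcd 24 (gcd (P - 1) (Q - 1)))"
    using exponent_table_residues res by blast
  then obtain a b c d where dvd: "24 dvd a + P * b + Q * c + P * Q * d"
    and s: "a + b + c + d dvd lcm 4 (gcd 24 (gcd (P - 1) (Q - 1)))"
    by (auto simp del: One_nat_def)
  have "int 4 dvd 2 * k" using k(1) by auto
  then have "4 dvd nat (2 * k)" "gcd 24 (gcd (P - 1) (Q - 1)) dvd nat (2 * k)"
    using k(2,3) gcd_24_pred_residues [of p q] \<open>P > 0\<close> \<open>Q > 0\<close>
    by (simp_all only: P_def Q_def int_dvd_int_iff [symmetric] nat_0_le mult_nonneg_nonneg zero_le_numeral)
  then have "a + b + c + d dvd nat (2 * k)"
    using s dvd_trans lcm_least by blast
  then obtain t where "nat (2 * k) = (a + b + c + d) * t" by (elim dvdE)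
  then have t: "2 * k = int ((a + b + c + d) * t)"
    using k(2) by (metis nat_0_le mult_nonneg_nonneg zero_le_numeral)
  have "24 dvd int (a + P * b + Q * c + P * Q * d) * int t"
    using dvd by (metis dvd_mult2 int_dvd_int_iff of_nat_numeral)
  then have "24 dvd int (a * t) + int P * int (b * t) + int Q * int (c * t) + int (P * Q) * int (d * t)"
    by (simp add: algebra_simps)
  then have "24 dvd int (a * t) + int p * int (b * t) + int q * int (c * t) + int (p * q) * int (d * t)"
    unfolding P_def Q_def by (subst dvd_24_residues)
  moreover have "int (a * t) + int (b * t) + int (c * t) + int (d * t) = 2 * k"
    unfolding t by (simp add: algebra_simps)
  ultimately show ?thesis
    by (intro modular_form_of_nonneg_exponents [OF pq]) auto
qed

text \<open>Each residue pair left out of the table contains a 5. Two exponents suffice here, at 1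
  and at the prime congruent to 5.\<close>

lemma modular_form_exists_residue_5:
  fixes p q :: nat and k :: int
  assumes pq: "prime p" "prime q" "p \<noteq> q" "p \<ge> 5" "q \<ge> 5"
    and k: "even k" "k \<ge> 0" "k \<noteq> 2" and res: "p mod 24 = 5 \<or> q mod 24 = 5"
  shows "\<exists>r. eta_quotient (p * q) r \<in> modular_forms k (Gamma1 (p * q))"
proof -
  obtain j where j: "k = 2 * j" using k(1) by (elim evenE)
  \<comment> \<open>\<open>2 k + 4 b = 4 (j + b)\<close> must vanish modulo 24, and \<open>b \<le> 2 k\<close> fails only for \<open>k = 2\<close>.\<close>
  define b where "b = (- j) mod 6"
  have b: "0 \<le> b" "b \<le> 2 * k" "24 dvd 2 * k - b + 5 * b"
    using k j unfolding b_def by presburger+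
  have 1: "24 dvd 2 * k - b + int p * b + int q * 0 + int (p * q) * 0" if "p mod 24 = 5"
    unfolding dvd_24_residues [of _ p] using b(3) that by simp
  have 2: "24 dvd 2 * k - b + int p * 0 + int q * b + int (p * q) * 0" if "q mod 24 = 5"
    unfolding dvd_24_residues [of _ p] using b(3) that by simp
  have "2 * k - b \<ge> 0" "2 * k - b + b + 0 + 0 = 2 * k" "2 * k - b + 0 + b + 0 = 2 * k"
    using b by simp_all
  then show ?thesis
    using res modular_form_of_nonneg_exponents [OF pq _ b(1) order_refl order_refl _ 1]
      modular_form_of_nonneg_exponents [OF pq _ order_refl b(1) order_refl _ 2] by blast
qed

section \<open>Obstructions to existence\<close>

lemma eta_quotient_modular_gcd_dvd:
  fixes p q :: nat
  assumes pq: "prime p" "prime q" "p \<noteq> q"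
    and f: "eta_quotient (p * q) r \<in> modular_forms k (Gamma1 (p * q))"
  shows "int (gcd 24 (gcd (p - 1) (q - 1))) dvd 2 * k"
proof -
  define g where "g = int (gcd 24 (gcd (p - 1) (q - 1)))"
  have pos: "p > 0" "q > 0" using pq prime_gt_0_nat by auto
  then have N: "p * q > 0" by simp
  have "g dvd int 24" "g dvd int (p - 1)" "g dvd int (q - 1)"
    unfolding g_def int_dvd_int_iff by (meson gcd_dvd1 gcd_dvd2 dvd_trans)+
  then have g: "g dvd 24" "g dvd int p - 1" "g dvd int q - 1"
    using pos by (simp_all add: of_nat_diff)
  have "24 dvd r 1 + int p * r p + int q * r q + int (p * q) * r (p * q)"
    using eta_quotient_modular_cong [OF N f] unfolding sum_divisors_semiprime [OF pq] by simp
  then have "g dvd r 1 + int p * r p + int q * r q + int (p * q) * r (p * q)"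
    using g(1) dvd_trans by blast
  \<comment> \<open>This is the difference between the sums of \<delta> r(\<delta>) and of
    r(\<delta>), rewritten with p q - 1 = (p - 1) q + (q - 1).\<close>
  moreover have "g dvd (int p - 1) * (r p + int q * r (p * q)) + (int q - 1) * (r q + r (p * q))"
    using g by (intro dvd_add dvd_mult2)
  ultimately have "g dvd r 1 + int p * r p + int q * r q + int (p * q) * r (p * q) -
      ((int p - 1) * (r p + int q * r (p * q)) + (int q - 1) * (r q + r (p * q)))"
    by (rule dvd_diff)
  also have "r 1 + int p * r p + int q * r q + int (p * q) * r (p * q) -
      ((int p - 1) * (r p + int q * r (p * q)) + (int q - 1) * (r q + r (p * q))) = 2 * k"
    using eta_quotient_modular_weight [OF N f] unfolding sum_divisors_semiprime [OF pq]
    by (simp add: algebra_simps)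
  finally show ?thesis by (simp only: g_def)
qed

text \<open>The exponents are nonnegative with sum 4, and the congruence reduces to 24 dividing 4 (1
  + s), where s is the sum of two of them. This would force s to be 5 modulo 6, but s lies between 0
  and 4.\<close>

lemma no_weight_2_exceptional:
  fixes p q :: nat
  assumes pq: "prime p" "prime q" "p \<noteq> q" "p \<ge> 5" "q \<ge> 5" "p \<noteq> 5" "q \<noteq> 5"
    and res: "(p mod 24, q mod 24) \<in> {(1, 5), (5, 1), (5, 5)}"
  shows "eta_quotient (p * q) r \<notin> modular_forms 2 (Gamma1 (p * q))"
proof
  assume f: "eta_quotient (p * q) r \<in> modular_forms 2 (Gamma1 (p * q))"
  have N: "p * q > 0" using pq by simp
  have "odd p" "odd q" using pq prime_odd_nat by auto
  then have "p \<ge> 7" "q \<ge> 7" using pq(4-7) by presburger+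
  note nonneg = weight_2_exponents_nonneg [OF pq(1-3) this f]
  have sum: "r 1 + r p + r q + r (p * q) = 4"
    using eta_quotient_modular_weight [OF N f] unfolding sum_divisors_semiprime [OF pq(1-3)] by simp
  have "24 dvd r 1 + int p * r p + int q * r q + int (p * q) * r (p * q)"
    using eta_quotient_modular_cong [OF N f] unfolding sum_divisors_semiprime [OF pq(1-3)] by simp
  then have dvd: "24 dvd r 1 + int (p mod 24) * r p + int (q mod 24) * r q
      + int (p mod 24 * (q mod 24)) * r (p * q)"
    by (subst (asm) dvd_24_residues)
  define a b c d where "a = r 1" and "b = r p" and "c = r q" and "d = r (p * q)"
  have cases: "24 dvd 4 + 4 * (c + d) \<or> 24 dvd 4 + 4 * (b + d) \<or> 24 dvd 4 + 4 * (b + c) + 24 * d"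
  proof -
    have a: "a = 4 - b - c - d" using sum by (simp add: a_def b_def c_def d_def)
    show ?thesis
      using res dvd unfolding a_def [symmetric] b_def [symmetric] c_def [symmetric] d_def [symmetric] a
      by (auto simp: algebra_simps)
  qed
  have "0 \<le> a" "0 \<le> b" "0 \<le> c" "0 \<le> d" "a + b + c + d = 4"
    using nonneg sum by (simp_all add: a_def b_def c_def d_def)
  then have range: "0 \<le> c + d" "c + d \<le> 4" "0 \<le> b + d" "b + d \<le> 4" "0 \<le> b + c" "b + c \<le> 4"
    by linarith+
  have ndvd: "\<not> 24 dvd 4 + 4 * s" if "0 \<le> s" "s \<le> 4" for s :: int
    using that by presburger
  have "24 dvd 4 + 4 * (b + c) + 24 * d \<longleftrightarrow> 24 dvd 4 + 4 * (b + c)"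
    by (rule dvd_add_left_iff) (rule dvd_triv_left)
  with cases show False
    using ndvd [OF range(1,2)] ndvd [OF range(3,4)] ndvd [OF range(5,6)] by blast
qed

theorem theorem1p10:
  fixes p q N h :: nat and k :: int
  assumes "prime p" and "prime q" and "p \<ge> 5" and "q \<ge> 5" and "p \<noteq> q"
    and "N = p * q"
    and "even k" and "k \<ge> 0"
    and "h = gcd 24 (gcd (p - 1) (q - 1)) div 2"
  shows "(\<exists>r :: nat \<Rightarrow> int. eta_quotient N r \<in> modular_forms k (Gamma1 (p * q))) \<longleftrightarrow>
    (int h dvd k \<and>
     \<not> ((p mod 24, q mod 24) \<in> {(1, 5), (5, 1), (5, 5)} \<and> p \<noteq> 5 \<and> q \<noteq> 5 \<and> k = 2))"
proof -
  note pq = \<open>prime p\<close> \<open>prime q\<close> \<open>p \<noteq> q\<close> \<open>p \<ge> 5\<close> \<open>q \<ge> 5\<close>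
  have "even (p - 1)" "even (q - 1)"
    using pq prime_odd_nat [of p] prime_odd_nat [of q] by auto
  then have "even (gcd 24 (gcd (p - 1) (q - 1)))"
    by simp
  \<comment> \<open>The gcd is even, so \<open>div\<close> is exact and \<open>h\<close> divides
    \<open>k\<close> exactly if the gcd divides \<open>2 * k\<close>.\<close>
  then have "gcd 24 (gcd (p - 1) (q - 1)) = 2 * h"
    using assms(9) by simp
  then have h: "int h dvd k \<longleftrightarrow> int (gcd 24 (gcd (p - 1) (q - 1))) dvd 2 * k"
    by simp
  show ?thesis
    unfolding \<open>N = p * q\<close> h
  proof (intro iffI conjI)
    assume "\<exists>r. eta_quotient (p * q) r \<in> modular_forms k (Gamma1 (p * q))"
    then obtain r where f: "eta_quotient (p * q) r \<in> modular_forms k (Gamma1 (p * q))" by blast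
    show "int (gcd 24 (gcd (p - 1) (q - 1))) dvd 2 * k"
      by (rule eta_quotient_modular_gcd_dvd [OF pq(1-3) f])
    show "\<not> ((p mod 24, q mod 24) \<in> {(1, 5), (5, 1), (5, 5)} \<and> p \<noteq> 5 \<and> q \<noteq> 5 \<and> k = 2)"
      using no_weight_2_exceptional [OF pq] f by blast
  next
    assume *: "int (gcd 24 (gcd (p - 1) (q - 1))) dvd 2 * k \<and>
      \<not> ((p mod 24, q mod 24) \<in> {(1, 5), (5, 1), (5, 5)} \<and> p \<noteq> 5 \<and> q \<noteq> 5 \<and> k = 2)"
    \<comment> \<open>For an exceptional residue pair, either the weight is not 2, and then a
      residue 5 suffices, or one of the primes is 5 itself.\<close>
    then consider "(p mod 24, q mod 24) \<notin> {(1, 5), (5, 1), (5, 5)}"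
      | "p mod 24 = 5 \<or> q mod 24 = 5" "k \<noteq> 2" | "p = 5 \<or> q = 5" "k = 2"
      by auto
    then show "\<exists>r. eta_quotient (p * q) r \<in> modular_forms k (Gamma1 (p * q))"
    proof cases
      case 1
      then show ?thesis
        using modular_form_exists_generic [OF pq assms(7,8)] * by blast
    next
      case 2
      then show ?thesis
        using modular_form_exists_residue_5 [OF pq assms(7,8)] by blast
    next
      case 3
      then show ?thesis
        using modular_form_level_5 [OF pq] by blast
    qed
  qed
qed

end
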